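(* The Markov chain $\widehat X_{\alpha\beta\gamma}$ has the following unique stationary distribution: \[ \textrm{Prob}(\widehat X_{\alpha\beta\gamma}(t)=\omega) \mathop{\longrightarrow}_{t\to\infty}\frac{q(\omega)}{\widehat Z_n}, \qquad\textrm{ where }\widehat Z_n=\sum_{\omega'\in\widehat \Omega_n}q(\omega'), \] where $q(\omega)=\beta^n\gamma^n(\alpha/\beta)^{n_y(\omega)}(\alpha/\gamma)^{n_z(\omega)}$.
   Context: Setting: the 3-TASEP with periodic boundary conditions, with parameters $\alpha,\beta,\gamma\in]0,1]$. A (basic) configuration is a row of $n$ cells arranged on a rigid circle (not considered up to rotation), each containing one particle of type black $\bullet$, neutral $\times$ or white $\circ$, with walls $0,\dots,n-1$ (walls $0$ and $n$ identified). The basic chain $\widehat S_{\alpha\beta\gamma}$: at each time step a wall is chosen uniformly at random; if the two cells around it read $\bullet|\circ$ they swap ($\to\circ|\bullet$) with probability $\alpha$; if they read $\times|\circ$ they swap ($\to\circ|\times$) with probability $\beta$; if they read $\bullet|\times$ they swap ($\to\times|\bullet$) with probability $\gamma$; otherwise nothing happens. The numbers $k,\ell,m$ of black, neutral and white particles are conserved, and one assumes $\ell\ge1$. Complete configurations: $\widehat\Omega_n$ is the set of pairs of rows of $n$ cells arranged on a circle such that the $\times$ particles only occur as columns with a $\times$ in both rows (``$\times\times$-columns''), and each subconfiguration between two consecutive $\times\times$-columns, read clockwise, satisfies (i) balance: it contains in its two rows together equally many black and white particles, and (ii) positivity: on the left of any wall inside it there are at least as many black as white particles (counting only that subconfiguration).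 Each such subconfiguration is a word in the four column types (top/bottom) $\bullet/\bullet$, $\bullet/\circ$, $\circ/\bullet$, $\circ/\circ$ and factors uniquely into prime pieces: single $\bullet/\circ$-columns, single $\circ/\bullet$-columns, and blocks of the form $|\bullet/\bullet|\,\omega'\,|\circ/\circ|$ with $\omega'$ again balanced and positive (the ``inside'' of the block). Labels are put independently in each subconfiguration: each white particle of the bottom row is labeled $z$ if it is not in a block; then each black particle of the bottom row is labeled $y$ if it is not in the inside of a block and there is no $z$ label on its left (within that subconfiguration). $n_y(\omega)$ and $n_z(\omega)$ denote the numbers of $y$ and $z$ labels. The complete chain $\widehat X_{\alpha\beta\gamma}$ on $\widehat\Omega_n$: a wall $i$ is chosen uniformly at random, and a transition is triggered with probability $\alpha$, $\beta$, $\gamma$ according as the top row around wall $i$ reads $\bullet|\circ$, $\times|\circ$, $\bullet|\times$ (otherwise nothing happens). When triggered, the top row is changed exactly as in $\widehat S_{\alpha\beta\gamma}$, and the bottom row is changed so that the two particles leaving/entering travel backwards: if the column to the right of wall $i$ is a $\circ/\bullet$-column (top/bottom), let $j_1$ be the wall reached from $i$ by going left (counterclockwise) across the maximal run of white top particles immediately to the left of wall $i$; this $\circ/\bullet$-column is moved to the right-hand side of wall $j_1$ (equivalently, the bottom-row white particles between $j_1$ and $i$ hop one step right). Otherwise (right column $\circ/\circ$, or left column $\bullet/\circ$ followed by a $\times\times$-column), let $j_2$ be the wall reached by going right (clockwise) across the maximal run of black top particles to the right of the moving black particle; the top black particle at wall $i$ and the bottom white particle at wall $i$ are removed and reinserted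 at wall $j_2$ as a black-top-left/white-bottom-right diagonal if a white top particle follows wall $j_2$, or as a $\bullet/\circ$-column otherwise (equivalently, a black sweep in the bottom row). These moves define a bijection $\widehat T$ of $\widehat\Omega_n\times\{0,\dots,n-1\}$ onto itself, and the top row of $\widehat X_{\alpha\beta\gamma}$ has the same law as $\widehat S_{\alpha\beta\gamma}$; the chain is irreducible when there is at least one $\times\times$-column. *)

theory Defs
  imports "HOL-Probability.Probability"
begin

datatype particle = Black | Neutral | White

text \<open>
  Rows are lists read clockwise, cells being numbered from 0. Wall i separates
  cell i - 1 from cell i, indices taken modulo the length of the row.
  A configuration of the complete chain is a pair (top row, bottom row), a column is a
  pair (top particle, bottom particle).
\<close>

type_synonym row = "particle list"
type_synonym column = "particle \<times> particle"
type_synonym config = "row \<times> row"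

definition left_cell :: "nat \<Rightarrow> nat \<Rightarrow> nat" where
  "left_cell n i = (i + n - 1) mod n"

definition blacks :: "column list \<Rightarrow> nat" where
  "blacks w = count_list (map fst w) Black + count_list (map snd w) Black"

definition whites :: "column list \<Rightarrow> nat" where
  "whites w = count_list (map fst w) White + count_list (map snd w) White"

definition balanced :: "column list \<Rightarrow> bool" where
  "balanced w \<longleftrightarrow> blacks w = whites w"

definition positive :: "column list \<Rightarrow> bool" where
  "positive w \<longleftrightarrow> (\<forall>j\<le>length w. whites (take j w) \<le> blacks (take j w))"

definition neutral_cells :: "config \<Rightarrow> nat set" where
  "neutral_cells \<omega> = {p. p < length (fst \<omega>) \<and> fst \<omega> ! p = Neutral \<and> snd \<omega> ! p = Neutral}"

text \<open>
  The subconfiguration that starts just after the neutral column in cell p: cut the circle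
  open at p and read up to the next neutral column, which is the one in cell p itself
  (that is, the end of the list) when there is no other one.
\<close>

definition subconfig :: "config \<Rightarrow> nat \<Rightarrow> column list" where
  "subconfig \<omega> p =
     takeWhile (\<lambda>c. c \<noteq> (Neutral, Neutral)) (tl (rotate p (zip (fst \<omega>) (snd \<omega>))))"

text \<open>
  The particle numbers of the top row are conserved by the dynamics, so they are part of the
  state space; those of the bottom row are then determined by balance.
\<close>

definition complete_configs :: "nat \<Rightarrow> nat \<Rightarrow> nat \<Rightarrow> config set" where
  "complete_configs k l m = {(t, b).
     length t = k + l + m \<and> length b = k + l + m \<and>
     count_list t Black = k \<and> count_list t Neutral = l \<and> count_list t White = m \<and>
     (\<forall>i < k + l + m. t ! i = Neutral \<longleftrightarrow> b ! i = Neutral) \<and>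
     (\<forall>p \<in> neutral_cells (t, b). balanced (subconfig (t, b) p) \<and> positive (subconfig (t, b) p))}"

definition word :: "column list \<Rightarrow> bool" where
  "word w \<longleftrightarrow> set w \<subseteq> {Black, White} \<times> {Black, White} \<and> balanced w \<and> positive w"

definition block :: "column list \<Rightarrow> column list" where
  "block v = (Black, Black) # v @ [(White, White)]"

definition prime_piece :: "column list \<Rightarrow> bool" where
  "prime_piece u \<longleftrightarrow>
     u = [(Black, White)] \<or> u = [(White, Black)] \<or> (\<exists>v. word v \<and> u = block v)"

definition factorization :: "column list \<Rightarrow> column list list \<Rightarrow> bool" where
  "factorization w us \<longleftrightarrow> concat us = w \<and> (\<forall>u \<in> set us. prime_piece u)"

definition in_block :: "column list \<Rightarrow> nat \<Rightarrow> bool" where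
  "in_block w p \<longleftrightarrow> (\<exists>us v us'. factorization w (us @ block v # us') \<and>
     length (concat us) \<le> p \<and> p < length (concat us) + length (block v))"

definition inside_block :: "column list \<Rightarrow> nat \<Rightarrow> bool" where
  "inside_block w p \<longleftrightarrow> (\<exists>us v us'. factorization w (us @ block v # us') \<and>
     length (concat us) < p \<and> p < length (concat us) + length (block v) - 1)"

definition z_label :: "column list \<Rightarrow> nat \<Rightarrow> bool" where
  "z_label w p \<longleftrightarrow> p < length w \<and> snd (w ! p) = White \<and> \<not> in_block w p"

definition y_label :: "column list \<Rightarrow> nat \<Rightarrow> bool" where
  "y_label w p \<longleftrightarrow> p < length w \<and> snd (w ! p) = Black \<and> \<not> inside_block w p \<and>
     (\<forall>p' < p. \<not> z_label w p')"

definition n_y :: "config \<Rightarrow> nat" where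
  "n_y \<omega> = (\<Sum>p \<in> neutral_cells \<omega>. card {j. y_label (subconfig \<omega> p) j})"

definition n_z :: "config \<Rightarrow> nat" where
  "n_z \<omega> = (\<Sum>p \<in> neutral_cells \<omega>. card {j. z_label (subconfig \<omega> p) j})"

definition weight :: "real \<Rightarrow> real \<Rightarrow> real \<Rightarrow> config \<Rightarrow> real" where
  "weight \<alpha> \<beta> \<gamma> \<omega> =
     \<beta> ^ length (fst \<omega>) * \<gamma> ^ length (fst \<omega>) * (\<alpha> / \<beta>) ^ n_y \<omega> * (\<alpha> / \<gamma>) ^ n_z \<omega>"

definition swap_prob :: "real \<Rightarrow> real \<Rightarrow> real \<Rightarrow> row \<Rightarrow> nat \<Rightarrow> real" where
  "swap_prob \<alpha> \<beta> \<gamma> t i =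
     (let x = t ! left_cell (length t) i; y = t ! i in
      if (x, y) = (Black, White) then \<alpha>
      else if (x, y) = (Neutral, White) then \<beta>
      else if (x, y) = (Black, Neutral) then \<gamma>
      else 0)"

definition swap_at :: "nat \<Rightarrow> row \<Rightarrow> row" where
  "swap_at i t = (let h = left_cell (length t) i in t[h := t ! i, i := t ! h])"

text \<open>Apply f to the arc formed by the r consecutive cells s, s + 1, ... of a circular row.\<close>

definition on_arc :: "(row \<Rightarrow> row) \<Rightarrow> nat \<Rightarrow> nat \<Rightarrow> row \<Rightarrow> row" where
  "on_arc f s r xs =
     (let ys = rotate s xs in rotate (length xs - s) (f (take r ys) @ drop r ys))"

definition first_to_end :: "row \<Rightarrow> row" where
  "first_to_end xs = tl xs @ [hd xs]"

definition last_to_front :: "row \<Rightarrow> row" where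
  "last_to_front xs = last xs # butlast xs"

text \<open>
  A triggered move at wall i. The runs are measured in the new top row t', where the moving
  white (black) particle stands immediately to the left (right) of wall i and is counted in
  the run; in t' such a run stops at the other moving particle at the latest, so it never wraps
  around the circle.

  First case: the white-over-black column right of wall i is moved to the right of the wall
  reached by crossing the run of white particles. In the top row this amounts to the swap, in
  the bottom row to moving the black particle of cell i across r cells.

  Second case: the bottom white particle at wall i stands in cell i, unless the column there is
  neutral, in which case it stands to its left. After its removal the bottom particles on its
  right move one cell to the left, and it is reinserted at wall i + r, either below the last
  black particle of the run or, as the lower end of a diagonal, below the white particle that
  follows the run.
\<close>

definition move :: "nat \<Rightarrow> config \<Rightarrow> config" where
  "move i \<omega> = (let t = fst \<omega>; b = snd \<omega>; n = length t; t' = swap_at i t in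
     if t ! i = White \<and> b ! i = Black then
       (let r = length (takeWhile (\<lambda>x. x = White) (rev (rotate i t'))) in
        (t', on_arc last_to_front ((i + n - r) mod n) (r + 1) b))
     else
       (let r = length (takeWhile (\<lambda>x. x = Black) (rotate i t'));
            e = (if t' ! ((i + r) mod n) = White then r + 1 else r) in
        (t', if t ! i = Neutral then on_arc first_to_end (left_cell n i) (e + 1) b
             else on_arc first_to_end i e b)))"

definition step :: "real \<Rightarrow> real \<Rightarrow> real \<Rightarrow> config \<Rightarrow> config pmf" where
  "step \<alpha> \<beta> \<gamma> \<omega> =
     do {
       i \<leftarrow> pmf_of_set {..<length (fst \<omega>)};
       triggered \<leftarrow> bernoulli_pmf (swap_prob \<alpha> \<beta> \<gamma> (fst \<omega>) i);
       return_pmf (if triggered then move i \<omega> else \<omega>)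
     }"

definition law_at :: "('a \<Rightarrow> 'a pmf) \<Rightarrow> 'a pmf \<Rightarrow> nat \<Rightarrow> 'a pmf" where
  "law_at K \<mu> t = ((\<lambda>\<nu>. bind_pmf \<nu> K) ^^ t) \<mu>"

definition stationary_distribution :: "'a set \<Rightarrow> ('a \<Rightarrow> 'a pmf) \<Rightarrow> 'a pmf \<Rightarrow> bool" where
  "stationary_distribution S K \<pi> \<longleftrightarrow> set_pmf \<pi> \<subseteq> S \<and> bind_pmf \<pi> K = \<pi>"

end

theory Submission
  imports Defs
begin

text \<open>
  Call a pair (configuration, wall) triggered if the move at that wall has positive probability.
  Removing the travelling material from a triggered pair leaves a circle with one column less:
  either a white-over-black column is removed that stands behind a column with non-white top,
  or a black sweep is undone, that is, the two columns at the wall are merged into one with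
  non-black top. The move reinserts the same material at the neighbouring position of the same
  kind. Hence the moves permute the triggered pairs. An insertion leaves all labels
  unchanged, except that it creates one y label (respectively z label) if it is made directly
  behind (respectively before) a neutral column, where the probability of the corresponding
  move is \<open>\<beta>\<close> (respectively \<open>\<gamma>\<close>) instead of \<open>\<alpha>\<close>. So weight times
  probability depends only on the smaller circle, and the weight is stationary.

  For convergence, bubble sort drives every configuration to one in which all whites and then all
  blacks follow the neutral columns, and there balance and positivity determine the bottom row;
  Doeblin's argument applies to this configuration.
\<close>

section \<open>Convergence of finite Markov chains\<close>

text \<open>Labels stay under control because of what they count: in a word factored into prime
  pieces, z labels are the black-over-white pieces and y labels the pieces before the first of them.
  A white-over-black column inserted behind a black top either sinks into a block or stands behind a
  z label, so no y label arises. Likewise a white-topped column that is split in two stays in its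
  block or turns from a single piece into a block.

  The obstacle is the circle: runs, arcs and words may cross the cut of the list, and indices are
  taken modulo its length. Since triggered moves commute with rotation, each triggered pair is
  studied on the circle cut at the wall where the travelling material arrives. There the material
  next to the cut and the run it has crossed reveal the move that produced them. This is why pairs
  are permuted: the arrival wall is the information that a configuration alone lacks. Injectivity is
  then enough, the set of pairs being finite.\<close>

lemma law_at_add: "law_at K \<mu> (s + t) = law_at K (law_at K \<mu> s) t"
  unfolding law_at_def by (metis add.commute comp_apply funpow_add)

lemma law_at_Suc: "law_at K \<mu> (Suc t) = bind_pmf (law_at K \<mu> t) K"
  by (simp add: law_at_def)

lemma law_at_0 [simp]: "law_at K \<mu> 0 = \<mu>"
  by (simp add: law_at_def)

lemma law_at_bind: "law_at K (bind_pmf \<mu> f) t = bind_pmf \<mu> (\<lambda>x. law_at K (f x) t)"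
  by (induction t) (simp_all add: law_at_Suc bind_assoc_pmf)

lemma law_at_eq_bind: "law_at K \<mu> t = bind_pmf \<mu> (\<lambda>x. law_at K (return_pmf x) t)"
  using law_at_bind[of K \<mu> return_pmf t] by (simp add: bind_return_pmf')

lemma set_pmf_law_at_subset:
  assumes "\<And>x. x \<in> S \<Longrightarrow> set_pmf (K x) \<subseteq> S" and "set_pmf \<mu> \<subseteq> S"
  shows "set_pmf (law_at K \<mu> t) \<subseteq> S"
  using assms by (induction t) (fastforce simp: law_at_Suc)+

lemma pmf_bind_finite:
  assumes "finite S" "set_pmf \<mu> \<subseteq> S"
  shows "pmf (bind_pmf \<mu> K) y = (\<Sum>x\<in>S. pmf \<mu> x * pmf (K x) y)"
  unfolding pmf_bind by (subst integral_measure_pmf_real[OF assms(1)]) (use assms in \<open>auto simp: mult.commute\<close>)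

definition l1_dist :: "'a set \<Rightarrow> 'a pmf \<Rightarrow> 'a pmf \<Rightarrow> real" where
  "l1_dist S \<mu> \<nu> = (\<Sum>x\<in>S. \<bar>pmf \<mu> x - pmf \<nu> x\<bar>)"

text \<open>Every row of the kernel gives \<open>a\<close> at least the mass \<open>e\<close>. The
  difference of the two laws has total mass 0, so this common part cancels, and what remains is
  non-negative with row sums \<open>1 - e\<close>. The choice \<open>e = 0\<close> says that a
  kernel never increases the distance.\<close>

lemma l1_dist_bind_le:
  fixes K :: "'a \<Rightarrow> 'a pmf"
  assumes S: "finite S" "set_pmf \<mu> \<subseteq> S" "set_pmf \<nu> \<subseteq> S" "\<And>x. x \<in> S \<Longrightarrow> set_pmf (K x) \<subseteq> S"
    and a: "a \<in> S" and e: "0 \<le> e" "\<And>x. x \<in> S \<Longrightarrow> e \<le> pmf (K x) a"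
  shows "l1_dist S (bind_pmf \<mu> K) (bind_pmf \<nu> K) \<le> (1 - e) * l1_dist S \<mu> \<nu>"
proof -
  let ?f = "\<lambda>x. pmf \<mu> x - pmf \<nu> x"
  let ?R = "\<lambda>x y. pmf (K x) y - (if y = a then e else 0)"
  have R: "0 \<le> ?R x y" if "x \<in> S" for x y using e that by auto
  have sumR: "(\<Sum>y\<in>S. ?R x y) = 1 - e" if "x \<in> S" for x
    using S(1) S(4)[OF that] a by (simp add: sum_subtractf sum_pmf_eq_1)
  have f0: "sum ?f S = 0" using S by (simp add: sum_subtractf sum_pmf_eq_1)
  have eq: "pmf (bind_pmf \<mu> K) y - pmf (bind_pmf \<nu> K) y = (\<Sum>x\<in>S. ?f x * ?R x y)" for y
  proof -
    have "(\<Sum>x\<in>S. ?f x * ?R x y)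
        = (\<Sum>x\<in>S. ?f x * pmf (K x) y) - sum ?f S * (if y = a then e else 0)"
      by (simp only: right_diff_distrib sum_subtractf flip: sum_distrib_right)
    then show ?thesis
      using f0 by (simp add: pmf_bind_finite[OF S(1,2)] pmf_bind_finite[OF S(1,3)]
          left_diff_distrib sum_subtractf)
  qed
  have "l1_dist S (bind_pmf \<mu> K) (bind_pmf \<nu> K) \<le> (\<Sum>y\<in>S. \<Sum>x\<in>S. \<bar>?f x\<bar> * ?R x y)"
    unfolding l1_dist_def eq
    by (intro sum_mono order.trans[OF sum_abs]) (simp add: abs_mult abs_of_nonneg[OF R])
  also have "\<dots> = (\<Sum>x\<in>S. \<bar>?f x\<bar> * (\<Sum>y\<in>S. ?R x y))"
    by (subst sum.swap) (simp only: sum_distrib_left)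
  also have "\<dots> = (1 - e) * l1_dist S \<mu> \<nu>"
    by (simp add: sumR l1_dist_def sum_distrib_left mult.commute cong: sum.cong)
  finally show ?thesis .
qed

lemma reachable_law_at:
  assumes "(x, y) \<in> {(x, y). y \<in> set_pmf (K x)}\<^sup>*"
  shows "\<exists>t. y \<in> set_pmf (law_at K (return_pmf x) t)"
  using assms
proof (induction rule: rtrancl_induct)
  case base
  show ?case by (rule exI[of _ 0]) simp
next
  case (step y z)
  then obtain t where "y \<in> set_pmf (law_at K (return_pmf x) t)" by blast
  with step(2) have "z \<in> set_pmf (law_at K (return_pmf x) (Suc t))" by (auto simp: law_at_Suc)
  then show ?case ..
qed

text \<open>
  Doeblin's argument: a state a with a holding probability that is reachable from everywhere
  is hit at one common time from all states with probability at least some e > 0, so the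
  kernel of that many steps contracts the total variation distance by 1 - e.
\<close>

lemma law_at_converges:
  fixes K :: "'a \<Rightarrow> 'a pmf"
  assumes fin: "finite S" and closed: "\<And>x. x \<in> S \<Longrightarrow> set_pmf (K x) \<subseteq> S"
    and a: "a \<in> S" "a \<in> set_pmf (K a)"
    and reach: "\<And>x. x \<in> S \<Longrightarrow> (x, a) \<in> {(x, y). y \<in> set_pmf (K x)}\<^sup>*"
    and pi: "stationary_distribution S K \<pi>" and mu: "set_pmf \<mu> \<subseteq> S"
  shows "(\<lambda>t. pmf (law_at K \<mu> t) y) \<longlonglongrightarrow> pmf \<pi> y"
proof -
  have "\<forall>x\<in>S. \<exists>t. a \<in> set_pmf (law_at K (return_pmf x) t)"
    using reach reachable_law_at[of _ a K] by blast
  then obtain T where T: "\<And>x. x \<in> S \<Longrightarrow> a \<in> set_pmf (law_at K (return_pmf x) (T x))"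
    by metis
  have stay: "a \<in> set_pmf (law_at K (return_pmf x) (T x + s))" if "x \<in> S" for x s
    by (induction s) (use T[OF that] a(2) in \<open>auto simp: law_at_Suc\<close>)
  \<comment> \<open>The successor makes \<open>N\<close> positive, so that the multiples of
    \<open>N\<close> index a subsequence.\<close>
  define N where "N = Suc (Max (T ` S))"
  let ?KN = "\<lambda>x. law_at K (return_pmf x) N"
  have hit: "a \<in> set_pmf (?KN x)" if "x \<in> S" for x
  proof -
    have "T x \<le> N" unfolding N_def using fin that by (simp add: le_SucI)
    then show ?thesis using stay[OF that, of "N - T x"] by simp
  qed
  define e where "e = Min ((\<lambda>x. pmf (?KN x) a) ` S)"
  have e_pos: "0 < e" unfolding e_def using fin a(1) hit
    by (subst Min_gr_iff) (auto simp: pmf_positive)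
  have e_le: "e \<le> pmf (?KN x) a" if "x \<in> S" for x
    unfolding e_def using fin that by simp
  have "e \<le> 1" using e_le[OF a(1)] pmf_le_1[of "?KN a" a] by linarith
  have setL: "set_pmf (law_at K \<nu> t) \<subseteq> S" if "set_pmf \<nu> \<subseteq> S" for \<nu> t
    using set_pmf_law_at_subset[of S K, OF closed that] by simp
  have pi': "set_pmf \<pi> \<subseteq> S" "bind_pmf \<pi> K = \<pi>"
    using pi by (auto simp: stationary_distribution_def)
  have pi_law: "law_at K \<pi> t = \<pi>" for t
    by (induction t) (simp_all add: law_at_Suc pi')
  let ?d = "\<lambda>t. l1_dist S (law_at K \<mu> t) \<pi>"
  \<comment> \<open>Contraction with constant 0: the distance is monotone, so its limit along the
    multiples of \<open>N\<close> is its limit along all times.\<close>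
  have "?d (Suc t) \<le> (1 - 0) * ?d t" for t
    using l1_dist_bind_le[OF fin setL[OF mu, of t] pi'(1), of K a 0] closed a(1) pi'(2)
    by (simp add: law_at_Suc)
  then have dec: "decseq ?d" by (simp add: decseq_Suc_iff)
  have step: "?d (t + N) \<le> (1 - e) * ?d t" for t
  proof -
    have "?d (t + N) = l1_dist S (bind_pmf (law_at K \<mu> t) ?KN) (bind_pmf \<pi> ?KN)"
      using law_at_eq_bind[of K \<pi> N] law_at_eq_bind[of K "law_at K \<mu> t" N]
      by (simp add: law_at_add pi_law)
    also have "\<dots> \<le> (1 - e) * ?d t"
      by (rule l1_dist_bind_le[OF fin setL[OF mu] pi'(1) setL a(1)])
        (use e_pos e_le in auto)
    finally show ?thesis .
  qed
  have geo: "?d (j * N) \<le> (1 - e) ^ j * ?d 0" for j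
  proof (induction j)
    case (Suc j)
    have "?d (Suc j * N) \<le> (1 - e) * ?d (j * N)" using step[of "j * N"] by (simp add: add.commute)
    also have "\<dots> \<le> (1 - e) * ((1 - e) ^ j * ?d 0)"
      using Suc \<open>e \<le> 1\<close> by (intro mult_left_mono) auto
    finally show ?case by simp
  qed simp
  have d0: "0 \<le> ?d t" for t by (simp add: l1_dist_def sum_nonneg)
  have "(\<lambda>j. (1 - e) ^ j * ?d 0) \<longlonglongrightarrow> 0"
    using e_pos \<open>e \<le> 1\<close> by (intro tendsto_mult_left_zero LIMSEQ_realpow_zero) auto
  then have sub: "(\<lambda>j. ?d (j * N)) \<longlonglongrightarrow> 0"
    by (rule tendsto_sandwich[OF _ _ tendsto_const, rotated 2]) (use geo d0 in auto)
  obtain L where L: "?d \<longlonglongrightarrow> L"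
    using decseq_convergent[OF dec, of 0] d0 by blast
  have "strict_mono (\<lambda>j. j * N)" by (rule strict_monoI) (simp only: N_def mult_less_cancel2 zero_less_Suc)
  from LIMSEQ_subseq_LIMSEQ[OF L this] sub have "L = 0"
    by (auto simp: o_def intro: LIMSEQ_unique)
  show ?thesis
  proof (cases "y \<in> S")
    case True
    have le: "norm (pmf (law_at K \<mu> t) y - pmf \<pi> y) \<le> ?d t" for t
      unfolding real_norm_def
      unfolding l1_dist_def by (rule member_le_sum[OF True]) (use fin in auto)
    have "(\<lambda>t. pmf (law_at K \<mu> t) y - pmf \<pi> y) \<longlonglongrightarrow> 0"
      by (rule Lim_null_comparison[OF always_eventually, OF allI, OF le]) (use L \<open>L = 0\<close> in simp)
    then show ?thesis by (simp add: LIM_zero_iff)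
  next
    case False
    then have "pmf (law_at K \<mu> t) y = 0" for t using setL[OF mu, of t] by (auto simp: set_pmf_iff)
    moreover have "pmf \<pi> y = 0" using False pi'(1) by (auto simp: set_pmf_iff)
    ultimately show ?thesis by simp
  qed
qed

section \<open>Words and their labels\<close>

definition excess :: "column list \<Rightarrow> int" where
  "excess w = int (blacks w) - int (whites w)"

lemma excess_simps [simp]:
  "excess [] = 0"
  "excess ((a, b) # w) =
     (if a = Black then 1 else 0) + (if b = Black then 1 else 0)
     - (if a = White then 1 else 0) - (if b = White then 1 else 0) + excess w"
  "excess (u @ v) = excess u + excess v"
  by (auto simp: excess_def blacks_def whites_def)

text \<open>Prefixes are written as left factors instead of through \<open>take\<close>, so that
  positivity of a composite word can be read off from how two factorizations overlap.\<close>

lemma word_iff: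
  "word w \<longleftrightarrow> set w \<subseteq> {Black, White} \<times> {Black, White} \<and> excess w = 0 \<and>
     (\<forall>u v. w = u @ v \<longrightarrow> 0 \<le> excess u)"
proof -
  have "positive w \<longleftrightarrow> (\<forall>u v. w = u @ v \<longrightarrow> 0 \<le> excess u)"
  proof
    assume p: "positive w"
    show "\<forall>u v. w = u @ v \<longrightarrow> 0 \<le> excess u"
    proof (intro allI impI)
      fix u v assume w: "w = u @ v"
      then have "take (length u) w = u" "length u \<le> length w" by auto
      with p show "0 \<le> excess u" unfolding positive_def excess_def by fastforce
    qed
  next
    assume r: "\<forall>u v. w = u @ v \<longrightarrow> 0 \<le> excess u"
    show "positive w" unfolding positive_def
    proof (intro allI impI)
      fix j assume "j \<le> length w"
      have "w = take j w @ drop j w" by simp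
      with r have "0 \<le> excess (take j w)" by blast
      then show "whites (take j w) \<le> blacks (take j w)" by (simp add: excess_def)
    qed
  qed
  then show ?thesis by (auto simp: word_def balanced_def excess_def)
qed

lemma word_Nil [simp]: "word []"
  by (simp add: word_iff)

lemma word_append:
  assumes "word u" "word v" shows "word (u @ v)"
  using assms unfolding word_iff by (auto simp: append_eq_append_conv2)

lemma word_concat: "\<forall>u\<in>set us. word u \<Longrightarrow> word (concat us)"
  by (induction us) (auto intro: word_append)

lemma word_append_cancel:
  assumes "word (u @ v)" "word u" shows "word v"
proof -
  have "0 \<le> excess x" if "v = x @ y" for x y
  proof -
    have "u @ v = (u @ x) @ y" using that by simp
    then have "0 \<le> excess (u @ x)" using assms(1) unfolding word_iff by blast
    then show ?thesis using assms(2) by (simp add: word_iff)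
  qed
  then show ?thesis using assms by (auto simp: word_iff)
qed

lemma word_block:
  assumes "word v" shows "word (block v)"
proof -
  have "0 \<le> excess x" if "block v = x @ y" for x y
  proof (cases x)
    case (Cons a x')
    then have x: "x = (Black, Black) # x'" "v @ [(White, White)] = x' @ y"
      using that by (auto simp: block_def)
    then consider z where "v = x' @ z" | "x' = v @ [(White, White)]"
      by (auto simp: append_eq_append_conv2 Cons_eq_append_conv)
    then show ?thesis
    proof cases
      case 1
      then have "0 \<le> excess x'" using assms unfolding word_iff by blast
      then show ?thesis using x by simp
    next
      case 2
      then have "excess x' = - 2" using assms by (simp add: word_iff)
      then show ?thesis using x by simp
    qed
  qed simp
  then show ?thesis using assms by (auto simp: word_iff block_def)
qed

lemma word_prime:
  assumes "prime_piece u" shows "word u"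
proof -
  have "word [(Black, White)]" "word [(White, Black)]"
    by (auto simp: word_iff Cons_eq_append_conv)
  then show ?thesis using assms word_block unfolding prime_piece_def by blast
qed

text \<open>Prefixes that end outside the exchanged factor keep their excess. One that ends inside,
  after a part \<open>x\<close> of the factor, is compared with the prefix in front of the factor if
  \<open>0 \<le> excess x\<close>, and otherwise with the prefix that includes the whole factor,
  whose excess is common to \<open>c\<close> and \<open>d\<close>.\<close>

lemma word_insert_iff:
  assumes "excess c = excess d"
    and "set c \<subseteq> {Black, White} \<times> {Black, White}" "set d \<subseteq> {Black, White} \<times> {Black, White}"
    and "\<forall>x y. c = x @ y \<longrightarrow> 0 \<le> excess x \<or> excess d \<le> excess x"
    and "\<forall>x y. d = x @ y \<longrightarrow> 0 \<le> excess x \<or> excess c \<le> excess x"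
  shows "word (u @ c @ v) \<longleftrightarrow> word (u @ d @ v)"
proof -
  have *: "word (u @ d @ v)" if w: "word (u @ c @ v)"
    and cd: "excess c = excess d" and d: "set d \<subseteq> {Black, White} \<times> {Black, White}"
    and h: "\<forall>x y. d = x @ y \<longrightarrow> 0 \<le> excess x \<or> excess c \<le> excess x" for c d
  proof -
    have pre: "0 \<le> excess x" if "u @ c @ v = x @ y" for x y
      using w that unfolding word_iff by blast
    have hu: "0 \<le> excess u" using pre[of u "c @ v"] by simp
    have huc: "0 \<le> excess u + excess c" using pre[of "u @ c" v] by simp
    have "0 \<le> excess x" if eq: "u @ d @ v = x @ y" for x y
    proof -
      consider z where "u = x @ z" | z z' where "x = u @ z" "d = z @ z'" | z where "x = u @ d @ z" "v = z @ y"
        using eq by (auto simp: append_eq_append_conv2)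
      then show ?thesis
      proof cases
        case 1 then show ?thesis using pre[of x "z @ c @ v"] by simp
      next
        case 2 then show ?thesis using h hu huc by fastforce
      next
        case 3 then show ?thesis using pre[of "u @ c @ z" y] by (simp add: cd)
      qed
    qed
    then show ?thesis using w cd d by (auto simp: word_iff)
  qed
  show ?thesis using *[of c d] *[of d c] assms by auto
qed

lemma word_insert_WB: "word (u @ (White, Black) # v) \<longleftrightarrow> word (u @ v)"
proof -
  have "word (u @ [(White, Black)] @ v) \<longleftrightarrow> word (u @ [] @ v)"
    by (rule word_insert_iff) (auto simp: Cons_eq_append_conv)
  then show ?thesis by simp
qed

lemma word_insert_BW: "word (u @ (Black, White) # v) \<longleftrightarrow> word (u @ v)"
proof -
  have "word (u @ [(Black, White)] @ v) \<longleftrightarrow> word (u @ [] @ v)"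
    by (rule word_insert_iff) (auto simp: Cons_eq_append_conv)
  then show ?thesis by simp
qed

text \<open>Both sides have the same total excess, and the only new intermediate prefix, ending in
  \<open>(Black, c)\<close>, adds 2 or 0.\<close>

lemma word_diagonal:
  assumes "c = Black \<or> c = White"
  shows "word (u @ (Black, c) # (White, White) # v) \<longleftrightarrow> word (u @ (White, c) # v)"
proof -
  have "word (u @ [(Black, c), (White, White)] @ v) \<longleftrightarrow> word (u @ [(White, c)] @ v)"
    by (rule word_insert_iff) (use assms in \<open>auto simp: Cons_eq_append_conv\<close>)
  then show ?thesis by simp
qed

section \<open>Unique factorization into prime pieces\<close>

lemma word_Cons_cases:
  assumes "word (x # w)"
  obtains "x = (Black, White)" "word w" | "x = (White, Black)" "word w" | "x = (Black, Black)"
proof -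
  have "0 \<le> excess [x]" using assms unfolding word_iff by (metis append_Cons append_Nil)
  moreover have "x \<in> {Black, White} \<times> {Black, White}" using assms by (auto simp: word_iff)
  ultimately show ?thesis
    using that word_insert_WB[of "[]" w] word_insert_BW[of "[]" w] assms by auto
qed

text \<open>The block ends where the excess first returns to 0. Each column changes the excess by an
  even number, so before that point it is at least 2. Hence the closing column consists of two white
  particles, and the interior, measured from height 2, is itself balanced and positive.\<close>

lemma block_split:
  assumes "word ((Black, Black) # w)"
  shows "\<exists>v w'. (Black, Black) # w = block v @ w' \<and> word v \<and> word w'"
proof -
  let ?W = "(Black, Black) # w"
  let ?P = "\<lambda>j. 0 < j \<and> j \<le> length ?W \<and> excess (take j ?W) = 0"
  have W: "set ?W \<subseteq> {Black, White} \<times> {Black, White}" "excess ?W = 0"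
      "\<And>u v. ?W = u @ v \<Longrightarrow> 0 \<le> excess u"
    using assms unfolding word_iff by blast+
  have ex: "?P (length ?W)" using W(2) by simp
  define j where "j = (LEAST j. ?P j)"
  have Pj: "?P j" unfolding j_def by (rule LeastI[of ?P, OF ex])
  have least: "0 < excess (take i ?W)" if "0 < i" "i < j" for i
  proof -
    have "\<not> ?P i" using that not_less_Least unfolding j_def by blast
    moreover have "0 \<le> excess (take i ?W)" using W(3)[of "take i ?W" "drop i ?W"] by simp
    ultimately show ?thesis using that Pj by auto
  qed
  have "j \<noteq> 1" using Pj by auto
  then have "2 \<le> j" using Pj by simp
  then obtain i where ji: "j = Suc (Suc i)" by (metis add_2_eq_Suc le_Suc_ex)
  have i: "i < length w" using Pj ji by simp
  have tj: "take j ?W = (Black, Black) # take i w @ [w ! i]" using i ji by (simp add: take_Suc_conv_app_nth)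
  have ev: "even (excess u)" if "set u \<subseteq> {Black, White} \<times> {Black, White}" for u
    using that by (induction u) auto
  have hpos: "2 \<le> excess (take (Suc n) ?W)" if "n \<le> i" for n
  proof -
    have "even (excess (take (Suc n) ?W))"
      by (rule ev) (use W(1) set_take_subset in fastforce)
    moreover have "0 < excess (take (Suc n) ?W)" by (rule least) (use that ji in auto)
    ultimately show ?thesis by presburger
  qed
  obtain p q where pq: "w ! i = (p, q)" by force
  have "(p, q) \<in> {Black, White} \<times> {Black, White}" using W(1) i pq
    by (metis insert_subset list.simps(15) nth_mem subset_iff)
  moreover have "excess (take i w) + excess [w ! i] + 2 = 0" using Pj tj by simp
  ultimately have last: "w ! i = (White, White)" "excess (take i w) = 0"
    using hpos[of i] pq by (auto split: if_splits)
  have "word (take i w)" unfolding word_iff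
  proof (intro conjI allI impI)
    show "set (take i w) \<subseteq> {Black, White} \<times> {Black, White}" using W(1) set_take_subset by fastforce
  next
    fix u v assume uv: "take i w = u @ v"
    then have "length u \<le> i" using i by (metis append_take_drop_id length_append length_take min.absorb4 le_add1)
    moreover have "take (length u) (take i w) = u" using uv by simp
    ultimately have "take (length u) w = u" by (simp add: min_absorb1)
    then show "0 \<le> excess u" using hpos[of "length u"] \<open>length u \<le> i\<close> by simp
  qed (rule last)
  moreover have eq: "?W = block (take i w) @ drop (Suc i) w"
    using i last by (simp add: block_def) (metis id_take_nth_drop)
  ultimately have "word (drop (Suc i) w)"
    using word_append_cancel[of "block (take i w)"] assms word_prime[of "block (take i w)"]
    by (auto simp: prime_piece_def)
  with eq \<open>word (take i w)\<close> show ?thesis by blast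
qed

lemma prime_ne [simp]: "prime_piece u \<Longrightarrow> u \<noteq> []"
  by (auto simp: prime_piece_def block_def)

lemma word_factorization:
  assumes "word w" shows "\<exists>us. factorization w us"
  using assms
proof (induction w rule: length_induct)
  case (1 w)
  have step: "\<exists>us. factorization (u @ w') us" if "prime_piece u" "word w'" "w = u @ w'" for u w'
  proof -
    have "length w' < length w" using that by simp
    with 1 that obtain us where "factorization w' us" by blast
    then have "factorization (u @ w') (u # us)" using that by (simp add: factorization_def)
    then show ?thesis by blast
  qed
  show ?case
  proof (cases w)
    case Nil
    then have "factorization w []" by (simp add: factorization_def)
    then show ?thesis by blast
  next
    case (Cons x w')
    have "word (x # w')" using 1 Cons by simp
    then show ?thesis
    proof (cases rule: word_Cons_cases)
      case 1 then show ?thesis using step[of "[x]" w'] Cons by (simp add: prime_piece_def)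
    next
      case 2 then show ?thesis using step[of "[x]" w'] Cons by (simp add: prime_piece_def)
    next
      case 3
      then obtain v w'' where "w = block v @ w''" "word v" "word w''"
        using block_split \<open>word (x # w')\<close> Cons by metis
      then show ?thesis using step[of "block v" w''] by (auto simp: prime_piece_def)
    qed
  qed
qed

text \<open>The prime pieces form a prefix code: a non-empty proper prefix of a block lacks the
  closing column and thus has excess at least 2, while every prime piece has excess 0.\<close>

lemma prime_append_eq:
  assumes "prime_piece u" "prime_piece u'" "u @ w = u' @ w'"
  shows "u = u' \<and> w = w'"
proof -
  have *: "z = []" if px: "prime_piece x" and pxz: "prime_piece (x @ z)" for x z
  proof -
    have hx: "excess x = 0" using word_prime[OF px] by (simp add: word_iff)
    show ?thesis
    proof (cases "\<exists>v. word v \<and> x @ z = block v")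
      case True
      then obtain v where v: "word v" "x @ z = block v" by blast
      show ?thesis
      proof (rule ccontr)
        assume "z \<noteq> []"
        then obtain z' c where z: "z = z' @ [c]" by (metis rev_exhaust)
        obtain a x' where x: "x = a # x'" using prime_ne[OF px] by (cases x) auto
        have "a = (Black, Black)" and v': "v = x' @ z'" using v(2) by (auto simp: block_def x z)
        moreover have "0 \<le> excess x'" using v(1) v' unfolding word_iff by blast
        ultimately show False using hx x by simp
      qed
    next
      case False
      then have "x @ z = [(Black, White)] \<or> x @ z = [(White, Black)]"
        using pxz unfolding prime_piece_def by blast
      then have "length (x @ z) = 1" by (elim disjE) (simp_all del: length_append)
      then show ?thesis using prime_ne[OF px] by (cases x) auto
    qed
  qed
  from assms(3) consider z where "u = u' @ z" "z @ w = w'" | z where "u @ z = u'" "w = z @ w'"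
    by (auto simp: append_eq_append_conv2)
  then show ?thesis using * assms(1,2) by cases fastforce+
qed

lemma factorization_unique:
  "factorization w us \<Longrightarrow> factorization w us' \<Longrightarrow> us = us'"
  unfolding factorization_def
proof (induction us arbitrary: w us')
  case Nil
  then have "\<forall>u\<in>set us'. u = [] \<and> prime_piece u" by auto
  then show ?case by (cases us') (auto dest: prime_ne)
next
  case (Cons u us)
  have u: "prime_piece u" and eq: "concat us' = u @ concat us" using Cons.prems by simp_all
  have "us' \<noteq> []" using prime_ne[OF u] eq by auto
  then obtain u' us'' where us': "us' = u' # us''" by (cases us') auto
  have "u = u' \<and> concat us = concat us''"
    using Cons.prems us' eq by (intro prime_append_eq[OF u]) simp_all
  moreover have "us = us''" if "concat us = concat us''"
    by (rule Cons.IH[of "concat us"]) (use Cons.prems us' that in simp_all)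
  ultimately show ?case using us' by simp
qed

section \<open>Labels computed along the factorization\<close>

lemma in_block_iff:
  assumes "factorization w us"
  shows "in_block w p \<longleftrightarrow> (\<exists>us1 v us2. us = us1 @ block v # us2 \<and>
     length (concat us1) \<le> p \<and> p < length (concat us1) + length (block v))"
  using assms factorization_unique unfolding in_block_def by blast

lemma inside_block_iff:
  assumes "factorization w us"
  shows "inside_block w p \<longleftrightarrow> (\<exists>us1 v us2. us = us1 @ block v # us2 \<and>
     length (concat us1) < p \<and> p < length (concat us1) + length (block v) - 1)"
  using assms factorization_unique unfolding inside_block_def by blast

lemma factorization_Cons:
  "factorization (u @ w) (u # us) \<longleftrightarrow> prime_piece u \<and> factorization w us"
  by (auto simp: factorization_def)

text \<open>Positions behind the first piece are shifted by its length; \<open>p - length u\<close>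
  is used only where it does not truncate.\<close>

lemma block_position_Cons:
  assumes "u \<noteq> []" 
  shows "(\<exists>us1 v us2. u # us = us1 @ block v # us2 \<and>
     length (concat us1) \<le> p \<and> p < length (concat us1) + length (block v)) \<longleftrightarrow>
   (if p < length u then \<exists>v. u = block v
    else \<exists>us1 v us2. us = us1 @ block v # us2 \<and>
     length (concat us1) \<le> p - length u \<and> p - length u < length (concat us1) + length (block v))"
    (is "?L \<longleftrightarrow> ?R")
proof
  assume ?L
  then obtain us1 v us2 where *: "u # us = us1 @ block v # us2"
     "length (concat us1) \<le> p" "p < length (concat us1) + length (block v)" by blast
  show ?R
  proof (cases us1)
    case Nil then show ?thesis using * by auto
  next
    case (Cons a list)
    then have "a = u" "us = list @ block v # us2" "length u \<le> p" using * by auto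
    moreover have "length (concat list) \<le> p - length u" "p - length u < length (concat list) + length (block v)"
      using * Cons \<open>a = u\<close> \<open>length u \<le> p\<close> by auto
    ultimately show ?thesis by (metis not_less)
  qed
next
  assume R: ?R
  show ?L
  proof (cases "p < length u")
    case True
    then obtain v where "u = block v" using R by auto
    then show ?thesis using True by (intro exI[of _ "[]"] exI[of _ v] exI[of _ us]) auto
  next
    case False
    then obtain us1 v us2 where "us = us1 @ block v # us2" 
      "length (concat us1) \<le> p - length u" "p - length u < length (concat us1) + length (block v)"
      using R by auto
    then show ?thesis using False by (intro exI[of _ "u # us1"] exI[of _ v] exI[of _ us2]) auto
  qed
qed

lemma inside_position_Cons:
  assumes "u \<noteq> []" 
  shows "(\<exists>us1 v us2. u # us = us1 @ block v # us2 \<and>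
     length (concat us1) < p \<and> p < length (concat us1) + length (block v) - 1) \<longleftrightarrow>
   (if p < length u then (\<exists>v. u = block v) \<and> 0 < p \<and> p < length u - 1
    else \<exists>us1 v us2. us = us1 @ block v # us2 \<and>
     length (concat us1) < p - length u \<and> p - length u < length (concat us1) + length (block v) - 1)"
    (is "?L \<longleftrightarrow> ?R")
proof
  assume ?L
  then obtain us1 v us2 where *: "u # us = us1 @ block v # us2"
     "length (concat us1) < p" "p < length (concat us1) + length (block v) - 1" by blast
  show ?R
  proof (cases us1)
    case Nil then show ?thesis using * by auto
  next
    case (Cons a list)
    then have "a = u" "us = list @ block v # us2" "length u \<le> p" using * by auto
    moreover have "length (concat list) < p - length u" "p - length u < length (concat list) + length (block v) - 1"
      using * Cons \<open>a = u\<close> \<open>length u \<le> p\<close> by auto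
    ultimately show ?thesis by (metis not_less)
  qed
next
  assume R: ?R
  show ?L
  proof (cases "p < length u")
    case True
    then obtain v where "u = block v" using R by auto
    then show ?thesis using True R by (intro exI[of _ "[]"] exI[of _ v] exI[of _ us]) auto
  next
    case False
    then obtain us1 v us2 where "us = us1 @ block v # us2" 
      "length (concat us1) < p - length u" "p - length u < length (concat us1) + length (block v) - 1"
      using R by auto
    then show ?thesis using False by (intro exI[of _ "u # us1"] exI[of _ v] exI[of _ us2]) auto
  qed
qed

text \<open>Of the three kinds of pieces, only the black-over-white one has a bottom white particle
  outside a block.\<close>

lemma z_label_prime:
  assumes u: "prime_piece u" and w: "word w"
  shows "z_label (u @ w) p \<longleftrightarrow>
    (if p < length u then u = [(Black, White)] else z_label w (p - length u))"
proof -
  obtain us where us: "factorization w us" using word_factorization[OF w] by blast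
  then have us': "factorization (u @ w) (u # us)" using u by (simp add: factorization_Cons)
  have "in_block (u @ w) p \<longleftrightarrow> (if p < length u then \<exists>v. u = block v else in_block w (p - length u))"
    unfolding in_block_iff[OF us] in_block_iff[OF us'] using block_position_Cons u prime_ne by blast
  moreover have "p < length (u @ w) \<longleftrightarrow> p < length u \<or> p - length u < length w" by auto
  ultimately show ?thesis
  proof (cases "p < length u")
    case True
    then have "z_label (u @ w) p \<longleftrightarrow> snd (u ! p) = White \<and> (\<nexists>v. u = block v)"
      using \<open>in_block (u @ w) p \<longleftrightarrow> _\<close> by (simp add: z_label_def nth_append)
    then show ?thesis using True u by (auto simp: prime_piece_def block_def)
  qed (auto simp: z_label_def nth_append)
qed

text \<open>A first piece can carry a y label only in its first column: in a block the interior is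
  excluded and the closing column is white at the bottom. A black-over-white first piece carries a z
  label and so suppresses every y label behind it.\<close>

lemma y_label_prime:
  assumes u: "prime_piece u" and w: "word w"
  shows "y_label (u @ w) p \<longleftrightarrow> u \<noteq> [(Black, White)] \<and>
    (if p < length u then p = 0 else y_label w (p - length u))"
proof -
  obtain us where us: "factorization w us" using word_factorization[OF w] by blast
  then have us': "factorization (u @ w) (u # us)" using u by (simp add: factorization_Cons)
  have i: "inside_block (u @ w) p \<longleftrightarrow> (if p < length u then (\<exists>v. u = block v) \<and> 0 < p \<and> p < length u - 1
     else inside_block w (p - length u))"
    unfolding inside_block_iff[OF us] inside_block_iff[OF us'] using inside_position_Cons u prime_ne by blast
  have z: "(\<forall>p'<p. \<not> z_label (u @ w) p') \<longleftrightarrow> (if p < length u then u = [(Black, White)] \<longrightarrow> p = 0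
     else u \<noteq> [(Black, White)] \<and> (\<forall>p'<p - length u. \<not> z_label w p'))"
    (is "?L \<longleftrightarrow> ?R")
  proof (cases "p < length u")
    case True
    then show ?thesis using z_label_prime[OF u w] by (cases p) auto
  next
    case False
    show ?thesis
    proof
      assume L: ?L
      have "\<not> z_label w p'" if "p' < p - length u" for p'
        using L[rule_format, of "p' + length u"] that z_label_prime[OF u w] by auto
      moreover have "u \<noteq> [(Black, White)]" using L[rule_format, of 0] False z_label_prime[OF u w, of 0] prime_ne[OF u]
        by (cases u) auto
      ultimately show ?R using False by simp
    next
      assume ?R then show ?L using False z_label_prime[OF u w] by (auto split: if_splits)
    qed
  qed
  show ?thesis
  proof (cases "p < length u")
    case True
    then have "y_label (u @ w) p \<longleftrightarrow> snd (u ! p) = Black \<and> \<not> ((\<exists>v. u = block v) \<and> 0 < p \<and> p < length u - 1) \<and>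
        (u = [(Black, White)] \<longrightarrow> p = 0)"
      unfolding y_label_def i z by (simp add: nth_append)
    also have "\<dots> \<longleftrightarrow> u \<noteq> [(Black, White)] \<and> p = 0"
    proof -
      from u consider "u = [(Black, White)]" | "u = [(White, Black)]" | v where "u = block v"
        unfolding prime_piece_def by blast
      then show ?thesis
      proof cases
        case 3
        then have "p = 0 \<or> 0 < p \<and> p < length u - 1 \<or> p = Suc (length v)" using True by (auto simp: block_def)
        then show ?thesis using 3 by (auto simp: block_def nth_append)
      qed (use True in auto)
    qed
    finally show ?thesis using True by simp
  next
    case False
    then show ?thesis unfolding y_label_def i z by (auto simp: nth_append)
  qed
qed

definition y_count :: "column list \<Rightarrow> nat" where
  "y_count w = card {j. y_label w j}"

definition z_count :: "column list \<Rightarrow> nat" where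
  "z_count w = card {j. z_label w j}"

lemma finite_labels [simp]: "finite {j. y_label w j}" "finite {j. z_label w j}"
  by (rule finite_subset[of _ "{..<length w}"]; auto simp: y_label_def z_label_def)+

lemma counts_Nil [simp]: "y_count [] = 0" "z_count [] = 0"
  by (simp_all add: y_count_def z_count_def y_label_def z_label_def)

lemma card_shift: "card {j. a \<le> j \<and> P (j - a)} = card {j :: nat. P j}"
proof -
  have "{j. a \<le> j \<and> P (j - a)} = (+) a ` {j. P j}"
    by (auto simp: image_iff) (metis le_add_diff_inverse)
  then show ?thesis by (simp add: card_image)
qed

text \<open>By this recursion \<open>y_count\<close> is the number of prime pieces before the first
  black-over-white one. Its companion for \<open>z_count\<close> counts the black-over-white
  pieces.\<close>

lemma y_count_prime:
  assumes "prime_piece u" "word w"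
  shows "y_count (u @ w) = (if u = [(Black, White)] then 0 else Suc (y_count w))"
proof (cases "u = [(Black, White)]")
  case True
  then have "{j. y_label (u @ w) j} = {}" using y_label_prime[OF assms] by blast
  then show ?thesis using True unfolding y_count_def by simp
next
  case False
  have "{j. y_label (u @ w) j} = insert 0 {j. length u \<le> j \<and> y_label w (j - length u)}"
    using False prime_ne[OF assms(1)] by (auto simp: y_label_prime[OF assms] split: if_splits)
  moreover have "finite {j. length u \<le> j \<and> y_label w (j - length u)}"
    by (rule finite_subset[of _ "{..<length u + length w}"]) (auto simp: y_label_def)
  moreover have "0 \<notin> {j. length u \<le> j \<and> y_label w (j - length u)}" using prime_ne[OF assms(1)] by simp
  ultimately show ?thesis using False unfolding y_count_def by (simp add: card_shift[of "length u" "y_label w"])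
qed

lemma z_count_prime:
  assumes "prime_piece u" "word w"
  shows "z_count (u @ w) = (if u = [(Black, White)] then Suc (z_count w) else z_count w)"
proof -
  have *: "{j. z_label (u @ w) j} = (if u = [(Black, White)] then {0} else {}) \<union> {j. length u \<le> j \<and> z_label w (j - length u)}"
    by (auto simp: z_label_prime[OF assms] split: if_splits)
  moreover have "finite {j. length u \<le> j \<and> z_label w (j - length u)}"
    by (rule finite_subset[of _ "{..<length u + length w}"]) (auto simp: z_label_def)
  ultimately show ?thesis
    unfolding z_count_def * by (auto simp: card_shift[of "length u" "z_label w"] card_shift[of 1 "z_label w", simplified])
qed

lemma word_induct [consumes 1, case_names Nil append]:
  assumes "word w" "P []" "\<And>u w. prime_piece u \<Longrightarrow> word w \<Longrightarrow> P w \<Longrightarrow> P (u @ w)"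
  shows "P w"
proof -
  have "P (concat us)" if "\<forall>u\<in>set us. prime_piece u" for us
    using that
  proof (induction us)
    case (Cons u us)
    then have "word (concat us)" by (intro word_concat) (auto intro: word_prime)
    then show ?case using Cons assms(3) by simp
  qed (simp add: assms(2))
  then show ?thesis using word_factorization[OF assms(1)] by (auto simp: factorization_def)
qed

lemma prime_singles [simp]: "prime_piece [(Black, White)]" "prime_piece [(White, Black)]"
  and prime_block: "word v \<Longrightarrow> prime_piece (block v)"
  by (auto simp: prime_piece_def)

lemma counts_single:
  assumes "word w"
  shows "y_count ((White, Black) # w) = Suc (y_count w)" "z_count ((White, Black) # w) = z_count w"
    and "y_count ((Black, White) # w) = 0" "z_count ((Black, White) # w) = Suc (z_count w)"
  using y_count_prime[OF _ assms, of "[(White, Black)]"] z_count_prime[OF _ assms, of "[(White, Black)]"]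
    y_count_prime[OF _ assms, of "[(Black, White)]"] z_count_prime[OF _ assms, of "[(Black, White)]"]
  by simp_all

section \<open>Effect of insertions on the label counts\<close>

text \<open>The new z label stands at the far end, where it has no y label behind it to
  suppress.\<close>

lemma counts_append_BW:
  assumes "word w"
  shows "y_count (w @ [(Black, White)]) = y_count w \<and> z_count (w @ [(Black, White)]) = Suc (z_count w)"
  using assms
proof (induction rule: word_induct)
  case Nil
  show ?case using counts_single(3,4)[OF word_Nil] by simp
next
  case (append u w)
  then have "word (w @ [(Black, White)])" by (simp add: word_insert_BW)
  then show ?case using append by (simp add: y_count_prime z_count_prime)
qed

text \<open>The closing column has a white top, so a column inserted behind a black top falls
  strictly inside the block.\<close>

lemma block_insert_WB:
  assumes "word v" "block v = a @ (Black, s) # r"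
  shows "\<exists>v'. word v' \<and> a @ (Black, s) # (White, Black) # r = block v'"
proof (cases a)
  case Nil
  then have "a @ (Black, s) # (White, Black) # r = block ((White, Black) # v)" "word ((White, Black) # v)"
    using assms word_insert_WB[of "[]" v] by (auto simp: block_def)
  then show ?thesis by blast
next
  case (Cons c a')
  then have a: "a = (Black, Black) # a'" "v @ [(White, White)] = a' @ (Black, s) # r"
    using assms(2) by (auto simp: block_def)
  then obtain r' where r: "r = r' @ [(White, White)]"
    by (cases r rule: rev_cases) auto
  then have "v = a' @ (Black, s) # r'" using a by simp
  then have "word (a' @ (Black, s) # (White, Black) # r')"
    using assms(1) word_insert_WB[of "a' @ [(Black, s)]" r'] by simp
  then show ?thesis using a r by (auto simp: block_def)
qed

text \<open>The opening column has a black top and cannot be the one that is split. Splitting the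
  closing column appends a black-over-white column to the interior; any other split happens within
  the interior.\<close>

lemma block_diagonal:
  assumes "word v" "block v = a @ (White, s) # r"
  shows "\<exists>v'. word v' \<and> a @ (Black, s) # (White, White) # r = block v'"
proof (cases a)
  case Nil
  then show ?thesis using assms by (simp add: block_def)
next
  case (Cons c a')
  then have a: "a = (Black, Black) # a'" "v @ [(White, White)] = a' @ (White, s) # r"
    using assms(2) by (auto simp: block_def)
  show ?thesis
  proof (cases r rule: rev_cases)
    case Nil
    then have "a @ (Black, s) # (White, White) # r = block (v @ [(Black, White)])"
      using a by (simp add: block_def)
    then show ?thesis using assms(1) word_insert_BW[of v "[]"] by auto
  next
    case (snoc r' d)
    then have v: "v = a' @ (White, s) # r'" and d: "d = (White, White)" using a by simp_all
    then have "s = Black \<or> s = White" using assms(1) by (auto simp: word_iff)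
    then have "word (a' @ (Black, s) # (White, White) # r')"
      using assms(1) v word_diagonal by simp
    then show ?thesis using a snoc d by (auto simp: block_def)
  qed
qed

text \<open>The black top belongs to a block, which absorbs the new column, or is a black-over-white
  piece. In the latter case the new column is a piece of its own, but it stands behind a z
  label.\<close>

lemma counts_insert_WB:
  assumes "word (a @ (Black, s) # r)"
  shows "y_count (a @ (Black, s) # (White, Black) # r) = y_count (a @ (Black, s) # r) \<and>
         z_count (a @ (Black, s) # (White, Black) # r) = z_count (a @ (Black, s) # r)"
proof -
  have "\<forall>a r. w = a @ (Black, s) # r \<longrightarrow>
     y_count (a @ (Black, s) # (White, Black) # r) = y_count w \<and>
     z_count (a @ (Black, s) # (White, Black) # r) = z_count w" if "word w" for w
    using that
  proof (induction rule: word_induct)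
    case (append u w)
    show ?case
    proof (intro allI impI)
      fix a r assume eq: "u @ w = a @ (Black, s) # r"
      consider (right) a' where "a = u @ a'" "w = a' @ (Black, s) # r"
        | (left) r' where "u = a @ (Black, s) # r'" "r = r' @ w"
        using eq by (auto simp: append_eq_append_conv2 append_eq_Cons_conv)
      then show "y_count (a @ (Black, s) # (White, Black) # r) = y_count (u @ w) \<and>
         z_count (a @ (Black, s) # (White, Black) # r) = z_count (u @ w)"
      proof cases
        case right
        have "word (a' @ (Black, s) # (White, Black) # r)"
          using append(2) right word_insert_WB[of "a' @ [(Black, s)]" r] by simp
        then show ?thesis using append right by (simp add: y_count_prime z_count_prime)
      next
        case left
        from append(1) consider "u = [(Black, White)]" | "u = [(White, Black)]" | v where "word v" "u = block v"
          unfolding prime_piece_def by blast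
        then show ?thesis
        proof cases
          case 1
          then have "a = []" "s = White" "r = w" using left by (auto simp: append_eq_Cons_conv)
          moreover have "word ((White, Black) # w)" using append(2) word_insert_WB[of "[]"] by simp
          ultimately show ?thesis using 1 append(2) by (simp add: counts_single)
        next
          case 2
          then show ?thesis using left by (auto simp: append_eq_Cons_conv)
        next
          case 3
          then obtain v' where v': "word v'" "a @ (Black, s) # (White, Black) # r' = block v'"
            using block_insert_WB left by metis
          have ne: "block x \<noteq> [(Black, White)]" for x by (simp add: block_def)
          have "a @ (Black, s) # (White, Black) # r = block v' @ w" using v'(2)[symmetric] left by simp
          then show ?thesis using 3 v'(1) append(2) ne
            by (simp add: y_count_prime z_count_prime prime_block)
        qed
      qed
    qed
  qed simp
  then show ?thesis using assms by blast
qed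

text \<open>The white top belongs to a block, which stays one block, or is a white-over-black piece.
  The latter becomes \<open>block []\<close>, which counts for y labels in the same way.\<close>

lemma counts_diagonal:
  assumes "word (a @ (White, s) # r)"
  shows "y_count (a @ (Black, s) # (White, White) # r) = y_count (a @ (White, s) # r) \<and>
         z_count (a @ (Black, s) # (White, White) # r) = z_count (a @ (White, s) # r)"
proof -
  have "s = Black \<or> s = White" using assms by (auto simp: word_iff)
  have "\<forall>a r. w = a @ (White, s) # r \<longrightarrow>
     y_count (a @ (Black, s) # (White, White) # r) = y_count w \<and>
     z_count (a @ (Black, s) # (White, White) # r) = z_count w" if "word w" for w
    using that
  proof (induction rule: word_induct)
    case (append u w)
    show ?case
    proof (intro allI impI)
      fix a r assume eq: "u @ w = a @ (White, s) # r"
      consider (right) a' where "a = u @ a'" "w = a' @ (White, s) # r"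
        | (left) r' where "u = a @ (White, s) # r'" "r = r' @ w"
        using eq by (auto simp: append_eq_append_conv2 append_eq_Cons_conv)
      then show "y_count (a @ (Black, s) # (White, White) # r) = y_count (u @ w) \<and>
         z_count (a @ (Black, s) # (White, White) # r) = z_count (u @ w)"
      proof cases
        case right
        have "word (a' @ (Black, s) # (White, White) # r)"
          using append(2) right word_diagonal[OF \<open>s = Black \<or> s = White\<close>] by simp
        then show ?thesis using append right by (simp add: y_count_prime z_count_prime)
      next
        case left
        have ne: "block x \<noteq> [(Black, White)]" for x by (simp add: block_def)
        from append(1) consider "u = [(Black, White)]" | "u = [(White, Black)]" | v where "word v" "u = block v"
          unfolding prime_piece_def by blast
        then show ?thesis
        proof cases
          case 1
          then show ?thesis using left by (auto simp: append_eq_Cons_conv)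
        next
          case 2
          then have "a = []" "s = Black" "r = w" using left by (auto simp: append_eq_Cons_conv)
          then have "a @ (Black, s) # (White, White) # r = block [] @ w" by (simp add: block_def)
          then show ?thesis using 2 append(2) ne y_count_prime[OF prime_block[OF word_Nil] append(2)]
              z_count_prime[OF prime_block[OF word_Nil] append(2)]
            by (simp add: counts_single)
        next
          case 3
          then obtain v' where v': "word v'" "a @ (Black, s) # (White, White) # r' = block v'"
            using block_diagonal left by metis
          have "a @ (Black, s) # (White, White) # r = block v' @ w" using v'(2)[symmetric] left by simp
          then show ?thesis using 3 v'(1) append(2) ne
            by (simp add: y_count_prime z_count_prime prime_block)
        qed
      qed
    qed
  qed simp
  then show ?thesis using assms by blast
qed

section \<open>Sums over the words of a circle\<close>

abbreviation neutral :: column where "neutral \<equiv> (Neutral, Neutral)"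

definition head_term :: "(column list \<Rightarrow> nat) \<Rightarrow> column list \<Rightarrow> nat" where
  "head_term g cs = (if hd cs = neutral then g (takeWhile (\<lambda>c. c \<noteq> neutral) (tl cs)) else 0)"

text \<open>The sum runs over all cells, with 0 at the non-neutral ones, so that rotating the circle
  merely permutes the summands.\<close>

definition circ_sum :: "(column list \<Rightarrow> nat) \<Rightarrow> column list \<Rightarrow> nat" where
  "circ_sum g cs = (\<Sum>p<length cs. head_term g (rotate p cs))"

definition lin_sum :: "(column list \<Rightarrow> nat) \<Rightarrow> column list \<Rightarrow> nat" where
  "lin_sum g cs = (\<Sum>p<length cs. head_term g (drop p cs))"

lemma circ_sum_rotate [simp]: "circ_sum g (rotate s cs) = circ_sum g cs"
proof (induction s)
  case (Suc s)
  have "circ_sum g (rotate1 ds) = circ_sum g ds" for ds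
  proof -
    have "circ_sum g (rotate1 ds) + head_term g ds = (\<Sum>p<Suc (length ds). head_term g (rotate p ds))"
      unfolding circ_sum_def by (subst sum.lessThan_Suc_shift) (simp add: rotate1_rotate_swap)
    also have "\<dots> = circ_sum g ds + head_term g ds" by (simp add: circ_sum_def)
    finally show ?thesis by simp
  qed
  then show ?case using Suc by simp
qed simp

lemma circ_sum_append_commute: "circ_sum g (u @ v) = circ_sum g (v @ u)"
  by (metis circ_sum_rotate rotate_append)

text \<open>What wraps around starts with the neutral column at the head, and
  \<open>takeWhile\<close> stops there just as it stops at the end of the list.\<close>

lemma circ_sum_lin_sum:
  assumes "cs = [] \<or> hd cs = neutral" shows "circ_sum g cs = lin_sum g cs"
  unfolding circ_sum_def lin_sum_def
proof (intro sum.cong refl)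
  fix p assume "p \<in> {..<length cs}"
  then have p: "p < length cs" by simp
  then obtain cs' where cs: "cs = neutral # cs'" using assms by (cases cs) auto
  show "head_term g (rotate p cs) = head_term g (drop p cs)"
  proof (cases p)
    case (Suc q)
    have "drop p cs \<noteq> []" using p by simp
    then obtain d ds where d: "drop p cs = d # ds" by (cases "drop p cs") auto
    have "rotate p cs = d # ds @ neutral # take q cs'"
      using p d cs Suc by (simp add: rotate_drop_take)
    moreover have "takeWhile (\<lambda>c. c \<noteq> neutral) (ds @ neutral # es) = takeWhile (\<lambda>c. c \<noteq> neutral) ds" for es
      by (induction ds) auto
    ultimately show ?thesis using d by (simp add: head_term_def)
  qed simp
qed

lemma lin_sum_Cons: "lin_sum g (c # cs) = head_term g (c # cs) + lin_sum g cs"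
  unfolding lin_sum_def by (simp add: sum.lessThan_Suc_shift del: sum.lessThan_Suc)

lemma lin_sum_append: "neutral \<notin> set a \<Longrightarrow> lin_sum g (a @ cs) = lin_sum g cs"
  by (induction a) (auto simp: lin_sum_Cons head_term_def)

lemma circ_sum_word:
  assumes "neutral \<notin> set a" "Q = [] \<or> hd Q = neutral"
  shows "circ_sum g (neutral # a @ Q) = g a + lin_sum g Q"
proof -
  have "takeWhile (\<lambda>c. c \<noteq> neutral) (a @ Q) = a"
    using assms by (cases Q) (auto simp: takeWhile_append)
  then show ?thesis using assms(1)
    by (simp add: circ_sum_lin_sum lin_sum_Cons head_term_def lin_sum_append)
qed

text \<open>The locality principle behind all insertions: \<open>a\<close>, \<open>b\<close> and
  \<open>Q\<close> depend on \<open>R\<close> alone, so exchanging the neutral-free factor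
  \<open>c\<close> affects the single word \<open>a @ c @ b\<close>, and it does so for every
  \<open>g\<close> at once. If \<open>R\<close> has only one neutral column, \<open>a\<close> and
  \<open>b\<close> lie on its two sides and \<open>Q\<close> is empty.\<close>

lemma circ_sum_slot:
  assumes "neutral \<in> set R"
  shows "\<exists>a b Q. neutral \<notin> set a \<and> neutral \<notin> set b \<and> set a \<subseteq> set R \<and> set b \<subseteq> set R \<and>
     (last R = neutral \<longrightarrow> a = []) \<and> (hd R = neutral \<longrightarrow> b = []) \<and>
     (\<forall>g c. neutral \<notin> set c \<longrightarrow> circ_sum g (c @ R) = g (a @ c @ b) + lin_sum g Q)"
proof -
  obtain b R' where R: "R = b @ neutral # R'" "neutral \<notin> set b"
    using split_list_first[OF assms] by blast
  obtain Q a where Q: "neutral # R' = Q @ neutral # a" "neutral \<notin> set a"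
    using split_list_last[of neutral "neutral # R'"] by auto
  then have hdQ: "Q = [] \<or> hd Q = neutral" by (cases Q) auto
  have RQ: "R = b @ Q @ neutral # a" using R Q by simp
  have "circ_sum g (c @ R) = g (a @ c @ b) + lin_sum g Q" if "neutral \<notin> set c" for g c
  proof -
    have "circ_sum g (c @ R) = circ_sum g (neutral # (a @ c @ b) @ Q)"
      using circ_sum_append_commute[of g "c @ b @ Q" "neutral # a"] RQ by simp
    then show ?thesis using circ_sum_word[OF _ hdQ, of "a @ c @ b" g] Q R that by simp
  qed
  moreover have "last R = neutral \<longrightarrow> a = []" using Q(2) RQ by (cases a rule: rev_cases) auto
  moreover have "hd R = neutral \<longrightarrow> b = []" using R by (cases b) auto
  moreover have "set a \<subseteq> set R" "set b \<subseteq> set R" unfolding RQ by auto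
  ultimately show ?thesis using Q(2) R(2) by blast
qed

section \<open>Insertions into admissible circles\<close>

definition proper :: "column list \<Rightarrow> bool" where
  "proper cs \<longleftrightarrow> neutral \<in> set cs \<and> (\<forall>c\<in>set cs. fst c = Neutral \<longleftrightarrow> snd c = Neutral)"

text \<open>A 0/1 count turns the condition on all words into a circular sum, so that admissibility
  and label counts are handled by the same slot lemma.\<close>

definition defects :: "column list \<Rightarrow> nat" where
  "defects w = (if balanced w \<and> positive w then 0 else 1)"

definition admissible :: "column list \<Rightarrow> bool" where
  "admissible cs \<longleftrightarrow> proper cs \<and> circ_sum defects cs = 0"

lemma proper_word:
  assumes "proper cs" "set w \<subseteq> set cs" "neutral \<notin> set w"
  shows "set w \<subseteq> {Black, White} \<times> {Black, White}"
proof
  fix c assume c: "c \<in> set w"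
  obtain p q where pq: "c = (p, q)" by force
  have "p = Neutral \<longleftrightarrow> q = Neutral"
    using assms(1,2) c pq unfolding proper_def by (metis fst_conv snd_conv subsetD)
  moreover have "\<not> (p = Neutral \<and> q = Neutral)" using assms(3) c pq by auto
  ultimately have "p \<noteq> Neutral" "q \<noteq> Neutral" by auto
  then show "c \<in> {Black, White} \<times> {Black, White}" using pq by (cases p; cases q) auto
qed

lemma defects_word: "set w \<subseteq> {Black, White} \<times> {Black, White} \<Longrightarrow> defects w = (if word w then 0 else 1)"
  by (simp add: defects_def word_def)

text \<open>Behind a neutral column the inserted column opens a word and is a first piece with a y
  label. Otherwise \<open>x\<close> has a black top and the counts inside its word do not
  change.\<close>

lemma circ_insert_WB:
  assumes "proper (x # R)" "fst x \<noteq> White"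
  shows "admissible (x # (White, Black) # R) \<longleftrightarrow> admissible (x # R)"
    and "admissible (x # R) \<Longrightarrow>
      circ_sum y_count (x # (White, Black) # R) = circ_sum y_count (x # R) + (if x = neutral then 1 else 0)"
    and "admissible (x # R) \<Longrightarrow>
      circ_sum z_count (x # (White, Black) # R) = circ_sum z_count (x # R)"
proof -
  let ?c = "(White, Black)"
  have p: "proper (x # ?c # R)" using assms by (auto simp: proper_def)
  have *: "circ_sum defects (x # ?c # R) = circ_sum defects (x # R) \<and>
     (circ_sum defects (x # R) = 0 \<longrightarrow>
      circ_sum y_count (x # ?c # R) = circ_sum y_count (x # R) + (if x = neutral then 1 else 0) \<and>
      circ_sum z_count (x # ?c # R) = circ_sum z_count (x # R))"
  proof (cases "x = neutral")
    case True
    \<comment> \<open>With \<open>x\<close> moved to the end, the slot lies directly behind a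
      neutral column, so its left part \<open>a\<close> is empty.\<close>
    have "neutral \<in> set (R @ [x])" using True by simp
    from circ_sum_slot[OF this] True
    obtain b Q where b: "neutral \<notin> set b" "set b \<subseteq> set (R @ [x])"
       "\<And>g c. neutral \<notin> set c \<Longrightarrow> circ_sum g (c @ R @ [x]) = g (c @ b) + lin_sum g Q"
      by (metis append_Nil last_snoc)
    have eq: "circ_sum g (x # c @ R) = g (c @ b) + lin_sum g Q" if "neutral \<notin> set c" for g c
      using b(3)[OF that] circ_sum_append_commute[of g "[x]" "c @ R"] by simp
    have s: "set b \<subseteq> {Black, White} \<times> {Black, White}"
      using proper_word[OF assms(1)] b by auto
    have w: "word (?c # b) \<longleftrightarrow> word b" using word_insert_WB[of "[]" b] by simp
    show ?thesis using eq[of "[]"] eq[of "[?c]"] True s w counts_single[of b]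
      by (auto simp: defects_word)
  next
    case False
    then have R: "neutral \<in> set R" using assms by (auto simp: proper_def)
    then obtain a b Q where ab: "neutral \<notin> set a" "neutral \<notin> set b" "set a \<subseteq> set R" "set b \<subseteq> set R"
       "\<And>g c. neutral \<notin> set c \<Longrightarrow> circ_sum g (c @ R) = g (a @ c @ b) + lin_sum g Q"
      using circ_sum_slot[OF R] by blast
    have s: "set a \<subseteq> {Black, White} \<times> {Black, White}" "set b \<subseteq> {Black, White} \<times> {Black, White}"
        "set [x] \<subseteq> {Black, White} \<times> {Black, White}"
      using proper_word[OF assms(1), of a] proper_word[OF assms(1), of b]
        proper_word[OF assms(1), of "[x]"] ab False by auto
    then obtain q where x: "x = (Black, q)" using assms(2) by auto
    have w: "word (a @ x # ?c # b) \<longleftrightarrow> word (a @ x # b)" using word_insert_WB[of "a @ [x]" b] by simp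
    \<comment> \<open>Here \<open>x\<close> itself is put into the slot, so the comparison takes
      place within one word.\<close>
    show ?thesis using ab(5)[of "[x]"] ab(5)[of "[x, ?c]"] False s w counts_insert_WB[of a q b] x
      by (auto simp: defects_word)
  qed
  then show "admissible (x # ?c # R) \<longleftrightarrow> admissible (x # R)"
    "admissible (x # R) \<Longrightarrow>
      circ_sum y_count (x # (White, Black) # R) = circ_sum y_count (x # R) + (if x = neutral then 1 else 0)"
    "admissible (x # R) \<Longrightarrow>
      circ_sum z_count (x # (White, Black) # R) = circ_sum z_count (x # R)"
    using p assms by (simp_all add: admissible_def)
qed

text \<open>The two columns that a non-black column becomes when a black sweep enters at its left.\<close>

definition split_col :: "column \<Rightarrow> column list" where
  "split_col x = (if x = neutral then [(Black, White), neutral] else [(Black, snd x), (White, White)])"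

text \<open>A neutral \<open>x\<close> receives a black-over-white column at the end of the word in
  front of it, hence one more z label. A white-topped \<open>x\<close> is split within its
  word.\<close>

lemma circ_split_col:
  assumes "proper (x # R)" "fst x \<noteq> Black"
  shows "admissible (split_col x @ R) \<longleftrightarrow> admissible (x # R)"
    and "admissible (x # R) \<Longrightarrow> circ_sum y_count (split_col x @ R) = circ_sum y_count (x # R)"
    and "admissible (x # R) \<Longrightarrow>
      circ_sum z_count (split_col x @ R) = circ_sum z_count (x # R) + (if x = neutral then 1 else 0)"
proof -
  have p: "proper (split_col x @ R)" using assms by (cases x) (auto simp: proper_def split_col_def)
  have *: "circ_sum defects (split_col x @ R) = circ_sum defects (x # R) \<and>
     (circ_sum defects (x # R) = 0 \<longrightarrow>
      circ_sum y_count (split_col x @ R) = circ_sum y_count (x # R) \<and>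
      circ_sum z_count (split_col x @ R) = circ_sum z_count (x # R) + (if x = neutral then 1 else 0))"
  proof (cases "x = neutral")
    case True
    have "neutral \<in> set (x # R)" using True by simp
    from circ_sum_slot[OF this] True
    obtain a Q where a: "neutral \<notin> set a" "set a \<subseteq> set (x # R)"
       "\<And>g c. neutral \<notin> set c \<Longrightarrow> circ_sum g (c @ x # R) = g (a @ c) + lin_sum g Q"
      by (metis append_Nil2 list.sel(1))
    have s: "set a \<subseteq> {Black, White} \<times> {Black, White}"
      using proper_word[OF assms(1)] a by auto
    have w: "word (a @ [(Black, White)]) \<longleftrightarrow> word a" using word_insert_BW[of a "[]"] by simp
    show ?thesis using a(3)[of "[]"] a(3)[of "[(Black, White)]"] True s w counts_append_BW[of a]
      by (auto simp: defects_word split_col_def)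
  next
    case False
    then have R: "neutral \<in> set R" using assms by (auto simp: proper_def)
    then obtain a b Q where ab: "neutral \<notin> set a" "neutral \<notin> set b" "set a \<subseteq> set R" "set b \<subseteq> set R"
       "\<And>g c. neutral \<notin> set c \<Longrightarrow> circ_sum g (c @ R) = g (a @ c @ b) + lin_sum g Q"
      using circ_sum_slot[OF R] by blast
    have s: "set a \<subseteq> {Black, White} \<times> {Black, White}" "set b \<subseteq> {Black, White} \<times> {Black, White}"
        "set [x] \<subseteq> {Black, White} \<times> {Black, White}"
      using proper_word[OF assms(1), of a] proper_word[OF assms(1), of b]
        proper_word[OF assms(1), of "[x]"] ab False by auto
    then obtain q where x: "x = (White, q)" and q: "q = Black \<or> q = White" using assms(2) by (cases x) auto
    show ?thesis using ab(5)[of "[x]"] ab(5)[of "split_col x"] False s word_diagonal[OF q, of a b]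
        counts_diagonal[of a q b] x
      by (auto simp: defects_word split_col_def)
  qed
  then show "admissible (split_col x @ R) \<longleftrightarrow> admissible (x # R)"
    "admissible (x # R) \<Longrightarrow> circ_sum y_count (split_col x @ R) = circ_sum y_count (x # R)"
    "admissible (x # R) \<Longrightarrow>
      circ_sum z_count (split_col x @ R) = circ_sum z_count (x # R) + (if x = neutral then 1 else 0)"
    using p assms by (simp_all add: admissible_def)
qed

section \<open>The moves as reinsertions\<close>

definition rot :: "nat \<Rightarrow> config \<Rightarrow> config" where
  "rot s \<omega> = (rotate s (fst \<omega>), rotate s (snd \<omega>))"

definition cfg :: "column list \<Rightarrow> config" where
  "cfg cs = (map fst cs, map snd cs)"

lemma cfg_rotate: "cfg (rotate s cs) = rot s (cfg cs)"
  by (simp add: cfg_def rot_def rotate_map)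

lemma cfg_inject [simp]: "cfg cs = cfg ds \<longleftrightarrow> cs = ds"
proof
  assume "cfg cs = cfg ds"
  then have "zip (map fst cs) (map snd cs) = zip (map fst ds) (map snd ds)" by (simp add: cfg_def)
  then show "cs = ds" by (simp add: zip_map_fst_snd)
qed simp

text \<open>The wall at which the reversed move of \<open>move i \<omega>\<close> takes place.\<close>

definition jump :: "nat \<Rightarrow> config \<Rightarrow> nat" where
  "jump i \<omega> = (let n = length (fst \<omega>); t' = swap_at i (fst \<omega>) in
     if fst \<omega> ! i = White \<and> snd \<omega> ! i = Black
     then (i + n - length (takeWhile (\<lambda>x. x = White) (rev (rotate i t')))) mod n
     else (i + length (takeWhile (\<lambda>x. x = Black) (rotate i t'))) mod n)"

lemma add_mod_inject:
  fixes i j s n :: nat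
  assumes "i < n" "j < n" "(s + i) mod n = (s + j) mod n" shows "i = j"
proof -
  \<comment> \<open>Addition modulo \<open>n\<close> is read as indexing into a rotation of a list
    with distinct entries.\<close>
  have "rotate s [0..<n] ! i = rotate s [0..<n] ! j" using assms by (simp add: nth_rotate)
  then show ?thesis using assms by (simp add: nth_eq_iff_index_eq)
qed

lemma left_cell_add:
  assumes "i < n" shows "left_cell n ((i + s) mod n) = (left_cell n i + s) mod n"
proof -
  obtain m where n: "n = Suc m" using assms by (cases n) auto
  have "((i + s) mod n + m) mod n = (i + s + m) mod n" by (rule mod_add_left_eq)
  moreover have "((i + m) mod n + s) mod n = (i + m + s) mod n" by (rule mod_add_left_eq)
  ultimately show ?thesis unfolding left_cell_def by (simp add: n ac_simps)
qed

lemma left_cell_less [simp]: "0 < n \<Longrightarrow> left_cell n i < n"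
  by (simp add: left_cell_def)

lemma rotate_list_update:
  assumes "j < length xs"
  shows "rotate s (xs[(j + s) mod length xs := v]) = (rotate s xs)[j := v]"
proof (rule nth_equalityI)
  fix k assume "k < length (rotate s (xs[(j + s) mod length xs := v]))"
  then have k: "k < length xs" by simp
  then have "(s + k) mod length xs < length xs" using mod_less_divisor[of "length xs" "s + k"] by linarith
  moreover have "(j + s) mod length xs < length xs"
    using mod_less_divisor[of "length xs" "j + s"] k by linarith
  moreover have "(j + s) mod length xs = (s + k) mod length xs \<longleftrightarrow> j = k"
    using add_mod_inject[OF k assms, of s] by (auto simp: add.commute)
  ultimately show "rotate s (xs[(j + s) mod length xs := v]) ! k = (rotate s xs)[j := v] ! k"
    using k by (simp add: nth_rotate nth_list_update)
qed simp

lemma length_swap_at [simp]: "length (swap_at i t) = length t"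
  by (simp add: swap_at_def Let_def)

lemma nth_rotate': "i < length xs \<Longrightarrow> rotate s xs ! i = xs ! ((i + s) mod length xs)"
  by (simp add: nth_rotate add.commute)

lemma swap_at_rotate:
  assumes "i < length t"
  shows "swap_at i (rotate s t) = rotate s (swap_at ((i + s) mod length t) t)"
proof -
  let ?n = "length t"
  have h: "left_cell ?n i < ?n" using assms by (intro left_cell_less) auto
  have "rotate s (t[(left_cell ?n i + s) mod ?n := a, (i + s) mod ?n := b])
      = (rotate s t)[left_cell ?n i := a, i := b]" for a b
    using rotate_list_update[of i "t[(left_cell ?n i + s) mod ?n := a]" s b]
      rotate_list_update[OF h, of s a] assms by simp
  then show ?thesis
    using assms h by (simp add: swap_at_def Let_def left_cell_add nth_rotate')
qed

text \<open>The condition \<open>0 < r\<close> is due to \<open>hd\<close> and \<open>last\<close>: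
  the maps in question keep the length only of non-empty lists. The two ways of rotating back agree
  because they differ by a multiple of the length.\<close>

lemma on_arc_rotate:
  assumes f: "\<And>ys. ys \<noteq> [] \<Longrightarrow> length (f ys) = length ys" and "0 < r" "xs \<noteq> []" and a: "a \<le> length xs"
  shows "on_arc f a r (rotate s xs) = rotate s (on_arc f ((a + s) mod length xs) r xs)"
proof -
  let ?n = "length xs" and ?m = "(a + s) mod length xs"
  let ?ys = "rotate (a + s) xs"
  let ?L = "f (take r ?ys) @ drop r ?ys"
  have ys: "rotate ?m xs = ?ys" by (metis rotate_conv_mod)
  have "length (f (take r ?ys)) = length (take r ?ys)" using assms by (intro f) auto
  then have L: "length ?L = ?n" by simp
  have "?m < ?n" using assms by simp
  moreover have "a + s = ?m + (a + s) div ?n * ?n" by simp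
  ultimately have "(s + (?n - ?m)) + a = (?n - a) + (a + s) div ?n * ?n + a" using a by linarith
  then have "s + (?n - ?m) = (?n - a) + (a + s) div ?n * ?n" by linarith
  then have "(s + (?n - ?m)) mod ?n = (?n - a) mod ?n" by simp
  then have "rotate (s + (?n - ?m)) ?L = rotate (?n - a) ?L"
    using rotate_conv_mod[of "s + (?n - ?m)" ?L] rotate_conv_mod[of "?n - a" ?L] L by metis
  then show ?thesis by (simp add: on_arc_def Let_def rotate_rotate ys)
qed

lemma length_arc_maps:
  "ys \<noteq> [] \<Longrightarrow> length (first_to_end ys) = length ys"
  "ys \<noteq> [] \<Longrightarrow> length (last_to_front ys) = length ys"
  by (auto simp: first_to_end_def last_to_front_def)

lemma swap_at_left:
  assumes "i < length t" shows "swap_at i t ! i = t ! left_cell (length t) i"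
  using assms by (simp add: swap_at_def Let_def)

text \<open>The disjunction \<open>cond\<close> makes the arc of a black sweep non-empty: unless the
  first case applies or the cell is neutral, a black particle crosses the wall and begins the run
  itself.\<close>

lemma move_jump_rotate:
  assumes n: "length (fst \<omega>) = n" "length (snd \<omega>) = n" and i: "i < n"
    and k: "k = (i + s) mod n"
    and cond: "fst \<omega> ! k = White \<and> snd \<omega> ! k = Black \<or> fst \<omega> ! k = Neutral \<or>
       fst \<omega> ! left_cell n k = Black"
  shows "move i (rot s \<omega>) = rot s (move k \<omega>)"
    and "(jump i (rot s \<omega>) + s) mod n = jump k \<omega>"
proof -
  obtain t b where \<omega>: "\<omega> = (t, b)" by force
  have len: "length t = n" "length b = n" and ne: "t \<noteq> []" "b \<noteq> []" "0 < n" using n i by (auto simp: \<omega>)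
  define t' where "t' = swap_at k t"
  have len': "length t' = n" by (simp add: t'_def len)
  have sw: "swap_at i (rotate s t) = rotate s t'" using swap_at_rotate[of i t s] i len k by (simp add: t'_def)
  have run: "rotate i (rotate s t') = rotate k t'"
    using rotate_conv_mod[of "i + s" t'] by (simp add: rotate_rotate k len')
  have nt: "rotate s t ! i = t ! k" "rotate s b ! i = b ! k" using i by (simp_all add: nth_rotate' len k)
  have add: "((x + y) mod n + s) mod n = ((x + s) mod n + y) mod n" for x y
    by (metis mod_add_left_eq add.assoc add.commute)
  define r1 where "r1 = length (takeWhile (\<lambda>x. x = White) (rev (rotate k t')))"
  define r2 where "r2 = length (takeWhile (\<lambda>x. x = Black) (rotate k t'))"
  have r1: "r1 \<le> n" unfolding r1_def using length_takeWhile_le[of _ "rev (rotate k t')"] len' by simp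
  have s1: "((i + n - r1) mod n + s) mod n = (k + n - r1) mod n"
    using add[of i "n - r1"] r1 k by simp
  have s2: "((i + r2) mod n + s) mod n = (k + r2) mod n" using add[of i r2] k by simp
  have s3: "rotate s t' ! ((i + r2) mod n) = t' ! ((k + r2) mod n)"
    using ne(3) s2 by (simp add: nth_rotate' len')
  show "(jump i (rot s \<omega>) + s) mod n = jump k \<omega>"
    unfolding jump_def \<omega> rot_def Let_def using sw run nt s1 s2 len
    by (simp add: r1_def[symmetric] r2_def[symmetric] t'_def[symmetric])
  define e where "e = (if t' ! ((k + r2) mod n) = White then r2 + 1 else r2)"
  have e: "0 < e" if "\<not> (t ! k = White \<and> b ! k = Black)" "t ! k \<noteq> Neutral"
  proof -
    have "k < n" using ne k by simp
    then have "t' ! k = Black" using cond that by (simp add: \<omega> t'_def swap_at_left len)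
    then have "hd (rotate k t') = Black" "rotate k t' \<noteq> []"
      using \<open>k < n\<close> len' hd_rotate_conv_nth[of t' k] ne(3) by force+
    then have "0 < r2" unfolding r2_def by (cases "rotate k t'") auto
    then show ?thesis by (simp add: e_def)
  qed
  have M1: "move i (rot s \<omega>) = (rotate s t',
      if t ! k = White \<and> b ! k = Black then on_arc last_to_front ((i + n - r1) mod n) (r1 + 1) (rotate s b)
      else if t ! k = Neutral then on_arc first_to_end (left_cell n i) (e + 1) (rotate s b)
      else on_arc first_to_end i e (rotate s b))"
    unfolding move_def \<omega> rot_def Let_def fst_conv snd_conv sw length_rotate len run nt
      r1_def[symmetric] r2_def[symmetric] s3 e_def[symmetric] by simp
  have M2: "move k \<omega> = (t',
      if t ! k = White \<and> b ! k = Black then on_arc last_to_front ((k + n - r1) mod n) (r1 + 1) b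
      else if t ! k = Neutral then on_arc first_to_end (left_cell n k) (e + 1) b
      else on_arc first_to_end k e b)"
    unfolding move_def \<omega> Let_def fst_conv snd_conv t'_def[symmetric] len
      r1_def[symmetric] r2_def[symmetric] e_def[symmetric] by simp
  have A1: "on_arc last_to_front ((i + n - r1) mod n) (r1 + 1) (rotate s b)
      = rotate s (on_arc last_to_front ((k + n - r1) mod n) (r1 + 1) b)"
    by (subst on_arc_rotate[OF length_arc_maps(2)]) (use ne s1 in \<open>simp_all add: len less_imp_le\<close>)
  have A2: "on_arc first_to_end (left_cell n i) (e + 1) (rotate s b)
      = rotate s (on_arc first_to_end (left_cell n k) (e + 1) b)"
    by (subst on_arc_rotate[OF length_arc_maps(1)])
      (use ne i in \<open>simp_all add: len k left_cell_add less_imp_le\<close>)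
  have A3: "on_arc first_to_end i e (rotate s b) = rotate s (on_arc first_to_end k e b)" if "0 < e"
    by (subst on_arc_rotate[OF length_arc_maps(1)]) (use ne i that in \<open>simp_all add: len k\<close>)
  show "move i (rot s \<omega>) = rot s (move k \<omega>)"
    unfolding M1 M2 A1 A2 using A3 e by (simp add: rot_def)
qed

lemma swap_prob_rotate:
  assumes "i < length t"
  shows "swap_prob \<alpha> \<beta> \<gamma> (rotate s t) i = swap_prob \<alpha> \<beta> \<gamma> t ((i + s) mod length t)"
  using assms left_cell_less[of "length t" i]
  by (cases "length t = 0") (simp_all add: swap_prob_def Let_def nth_rotate' left_cell_add)

text \<open>
  The two kinds of triggered moves, on a circle cut open at the wall where the reversed move
  takes place. Both insert material into one and the same circle with one column less:
  a white-over-black column behind a non-white column (x, respectively the last one), or a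
  black sweep at a non-black column (x, respectively the first one).
\<close>

definition white_move :: "column list \<Rightarrow> nat \<Rightarrow> column list \<Rightarrow> bool" where
  "white_move cs i cs' \<longleftrightarrow> (\<exists>u x v. cs = u @ x # (White, Black) # v \<and> i = Suc (length u) \<and>
     cs' = (White, Black) # u @ x # v \<and>
     (\<forall>c\<in>set u. fst c = White) \<and> fst x \<noteq> White \<and> fst (last (x # v)) \<noteq> White)"

definition black_move :: "column list \<Rightarrow> nat \<Rightarrow> column list \<Rightarrow> bool" where
  "black_move cs i cs' \<longleftrightarrow> (\<exists>z x v y w. cs = z @ split_col x @ v \<and> i = Suc (length z) \<and>
     z @ [x] = y # w \<and> cs' = tl (split_col y) @ w @ v @ [hd (split_col y)] \<and>
     (\<forall>c\<in>set v. fst c = Black) \<and> (x = neutral \<or> fst x = White) \<and> (y = neutral \<or> fst y = White))"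

lemma split_col_cases:
  assumes "x = neutral \<or> fst x = White"
  obtains "x = neutral" "split_col x = [(Black, White), neutral]"
  | q where "x = (White, q)" "split_col x = [(Black, q), (White, White)]"
  using assms by (cases x) (auto simp: split_col_def)

section \<open>Recovering a move from its result\<close>

lemma prefix_unique:
  assumes "u @ x # v = u' @ x' # v'" "\<forall>c\<in>set u. P c" "\<forall>c\<in>set u'. P c" "\<not> P x" "\<not> P x'"
  shows "u = u' \<and> x = x' \<and> v = v'"
proof -
  have "takeWhile P (u @ x # v) = u" "takeWhile P (u' @ x' # v') = u'"
    using assms(2-5) by (simp_all add: takeWhile_append)
  then have "u = u'" using assms(1) by metis
  then show ?thesis using assms(1) by simp
qed

text \<open>Behind the leading column of \<open>cs'\<close>, the list \<open>u\<close> is the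
  maximal run of white tops, and its length gives the wall.\<close>

lemma white_move_inj:
  assumes "white_move cs i cs'" "white_move ds j cs'" shows "cs = ds \<and> i = j"
  using assms prefix_unique[where P = "\<lambda>c. fst c = White"] unfolding white_move_def
  by (metis list.inject)

text \<open>The column behind the cut tells the kinds apart: white over black for one, neutral or
  white over white for the other.\<close>

lemma white_black_move_disjoint:
  assumes "white_move cs i cs'" "black_move ds j cs'" shows False
  using assms unfolding white_move_def black_move_def
  by (auto simp: split_col_def split: if_splits)

lemma black_move_inj:
  assumes "black_move cs i cs'" "black_move ds j cs'" shows "cs = ds \<and> i = j"
proof -
  obtain z x v y w where 1: "cs = z @ split_col x @ v" "i = Suc (length z)" "z @ [x] = y # w"
     "cs' = tl (split_col y) @ w @ v @ [hd (split_col y)]" "\<forall>c\<in>set v. fst c = Black"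
     "x = neutral \<or> fst x = White" "y = neutral \<or> fst y = White"
    using assms(1) unfolding black_move_def by blast
  obtain z' x' v' y' w' where 2: "ds = z' @ split_col x' @ v'" "j = Suc (length z')" "z' @ [x'] = y' # w'"
     "cs' = tl (split_col y') @ w' @ v' @ [hd (split_col y')]" "\<forall>c\<in>set v'. fst c = Black"
     "x' = neutral \<or> fst x' = White" "y' = neutral \<or> fst y' = White"
    using assms(2) unfolding black_move_def by blast
  \<comment> \<open>The first column of \<open>cs'\<close> shows whether \<open>y\<close> is
    neutral, and the last one carries the bottom particle of \<open>y\<close> otherwise.\<close>
  have "y = y' \<and> w @ v = w' @ v'"
    using 1(4,7) 2(4,7)
    by (elim split_col_cases[of y] split_col_cases[of y']) auto
  then have "z @ x # v = z' @ x' # v'" using 1(3) 2(3)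
    by (metis append.assoc append_Cons append_Nil)
  \<comment> \<open>The black run \<open>v\<close> ends the list, so it is recovered as a maximal
    prefix after reversal.\<close>
  then have "rev v @ x # rev z = rev v' @ x' # rev z'"
    by (metis append_Cons append_Nil append_assoc rev.simps(2) rev_append rev_rev_ident)
  then have "rev v = rev v' \<and> x = x' \<and> rev z = rev z'"
    using 1(5,6) 2(5,6) by (intro prefix_unique[where P = "\<lambda>c. fst c = Black"]) auto
  then show ?thesis using 1 2 by simp
qed

section \<open>Moves on a suitably cut circle\<close>

text \<open>The arc starts at the first cell of \<open>q\<close> and may run past the end of the
  list into \<open>p\<close>. Of the new contents, \<open>A\<close> fills the cells of
  \<open>q\<close> and \<open>B\<close> those of \<open>p\<close>.\<close>

lemma on_arc_split:
  assumes "f (take r (q @ p)) @ drop r (q @ p) = A @ B" "length A = length q"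
  shows "on_arc f (length p) r (p @ q) = B @ A"
  using rotate_append[of p q] rotate_append[of A B] assms
  by (simp only: on_arc_def Let_def length_append diff_add_inverse)

lemma on_arc_prefix:
  assumes "length p = r" "length (f p) = r"
  shows "on_arc f 0 r (p @ q) = f p @ q"
  using assms by (simp add: on_arc_def Let_def)

lemma left_cell_Suc: "k < n \<Longrightarrow> Suc k < n \<Longrightarrow> left_cell n (Suc k) = k"
  by (simp add: left_cell_def)

lemma swap_at_append:
  "swap_at (Suc (length p)) (p @ x # y # q) = p @ y # x # q"
  by (simp add: swap_at_def Let_def left_cell_Suc nth_append list_update_append)

lemma white_move_move:
  assumes "white_move cs i cs'"
  shows "move i (cfg cs) = cfg cs'" "jump i (cfg cs) = 0"
    and "fst (cfg cs) ! i = White \<and> snd (cfg cs) ! i = Black"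
proof -
  obtain u x v where cs: "cs = u @ x # (White, Black) # v" and i: "i = Suc (length u)"
     and cs': "cs' = (White, Black) # u @ x # v" and u: "\<forall>c\<in>set u. fst c = White"
     and x: "fst x \<noteq> White" "fst (last (x # v)) \<noteq> White"
    using assms unfolding white_move_def by blast
  let ?ut = "map fst u" and ?vt = "map fst v"
  have t: "fst (cfg cs) = ?ut @ fst x # White # ?vt" and b: "snd (cfg cs) = (map snd u @ [snd x, Black]) @ map snd v"
    by (simp_all add: cs cfg_def)
  have n: "length (fst (cfg cs)) = length u + 2 + length v" by (simp add: t)
  have t': "swap_at i (fst (cfg cs)) = (?ut @ [White]) @ fst x # ?vt"
    using swap_at_append[of ?ut "fst x" White ?vt] i by (simp add: t)
  have ru: "rotate i ((?ut @ [White]) @ fst x # ?vt) = (fst x # ?vt) @ ?ut @ [White]"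
    using rotate_append[of "?ut @ [White]" "fst x # ?vt"] i by simp
  \<comment> \<open>Read leftwards from the wall, the run consists of the moved white particle and
    \<open>u\<close>. It then crosses the cut and stops at once at the last column of the
    list.\<close>
  have "takeWhile (\<lambda>x. x = White) (rev (fst x # ?vt)) = []"
  proof -
    have "hd (rev (fst x # ?vt)) = fst (last (x # v))" by (simp add: hd_rev last_map del: rev.simps)
    then show ?thesis using x(2) by (metis (mono_tags, lifting) hd_Cons_tl takeWhile.simps)
  qed
  moreover have "\<forall>y\<in>set (rev (?ut @ [White])). y = White" using u by auto
  ultimately have run: "length (takeWhile (\<lambda>x. x = White) (rev (rotate i (swap_at i (fst (cfg cs)))))) = Suc (length u)"
    unfolding t' ru rev_append[of "fst x # ?vt"] by (subst takeWhile_append2) auto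
  show w: "fst (cfg cs) ! i = White \<and> snd (cfg cs) ! i = Black"
    unfolding t b using i by (simp add: nth_append)
  have start: "(i + length (fst (cfg cs)) - Suc (length u)) mod length (fst (cfg cs)) = 0"
    unfolding n by (simp add: i)
  show "jump i (cfg cs) = 0"
    unfolding jump_def Let_def using w run start by simp
  have "on_arc last_to_front 0 (Suc (length u) + 1) (snd (cfg cs)) = Black # map snd u @ snd x # map snd v"
    unfolding b by (subst on_arc_prefix) (auto simp: last_to_front_def butlast_append)
  \<comment> \<open>Moving a white particle across a run of white ones is invisible in the top row,
    so the local swap looks like the transport of the whole column.\<close>
  moreover have "(?ut @ [White]) = White # ?ut" using u by (induction u) auto
  ultimately show "move i (cfg cs) = cfg cs'"
    unfolding move_def Let_def using w run start t' by (simp add: cs' cfg_def)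
qed

lemma black_move_move:
  assumes "black_move cs i cs'"
  shows "move i (cfg cs) = cfg cs'" "jump i (cfg cs) = 0"
    and "fst (cfg cs) ! left_cell (length cs) i = Black"
proof -
  obtain z x v y w where cs: "cs = z @ split_col x @ v" and i: "i = Suc (length z)" and zx: "z @ [x] = y # w"
     and cs': "cs' = tl (split_col y) @ w @ v @ [hd (split_col y)]" and v: "\<forall>c\<in>set v. fst c = Black"
     and x: "x = neutral \<or> fst x = White" and y: "y = neutral \<or> fst y = White"
    using assms unfolding black_move_def by blast
  let ?zt = "map fst z" and ?vt = "map fst v"
  let ?bx = "map snd (split_col x)"
  have t: "fst (cfg cs) = ?zt @ Black # fst x # ?vt" and b: "snd (cfg cs) = map snd z @ ?bx @ map snd v"
    using x by (auto simp: cs cfg_def split_col_def)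
  have n: "length (fst (cfg cs)) = length z + 2 + length v" "length cs = length z + 2 + length v"
    unfolding t using x by (auto simp: cs split_col_def)
  have t': "swap_at i (fst (cfg cs)) = (?zt @ [fst x]) @ Black # ?vt"
    using swap_at_append[of ?zt Black "fst x" ?vt] i by (simp add: t)
  have zxt: "?zt @ [fst x] = fst y # map fst w" using arg_cong[OF zx, of "map fst"] by simp
  have zxb: "map snd z @ [snd x] = snd y # map snd w" using arg_cong[OF zx, of "map snd"] by simp
  have ru: "rotate i ((?zt @ [fst x]) @ Black # ?vt) = (Black # ?vt) @ ?zt @ [fst x]"
    using rotate_append[of "?zt @ [fst x]" "Black # ?vt"] i by simp
  \<comment> \<open>By \<open>zxt\<close> the first cell behind the cut has top
    \<open>fst y\<close>, which is not black and ends the run.\<close>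
  have run: "length (takeWhile (\<lambda>x. x = Black) (rotate i (swap_at i (fst (cfg cs))))) = Suc (length v)"
    unfolding t' ru unfolding zxt using v y by (subst takeWhile_append2) auto
  have fin: "(i + Suc (length v)) mod length (fst (cfg cs)) = 0"
    unfolding n by (simp add: i)
  have "fst (cfg cs) ! i = fst x" "fst x = White \<longrightarrow> snd (cfg cs) ! i = White"
    unfolding t b using i x by (auto simp: nth_append split_col_def)
  then have nw: "\<not> (fst (cfg cs) ! i = White \<and> snd (cfg cs) ! i = Black)" and ti: "fst (cfg cs) ! i = fst x"
    by auto
  show "jump i (cfg cs) = 0"
    unfolding jump_def Let_def if_not_P[OF nw] using run fin by simp
  have lc: "left_cell (length z + 2 + length v) i = length z" using i by (simp add: left_cell_Suc)
  then show "fst (cfg cs) ! left_cell (length cs) i = Black"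
    unfolding n t by (simp add: nth_append)
  have t0: "swap_at i (fst (cfg cs)) ! 0 = fst y" by (simp add: t' zxt)
  have eq_t: "(?zt @ [fst x]) @ Black # ?vt = fst y # map fst w @ ?vt @ [Black]"
  proof -
    have "Black # ?vt = ?vt @ [Black]" using v by (induction v) auto
    then show ?thesis unfolding zxt by simp
  qed
  \<comment> \<open>The run consists of the moving black particle and \<open>v\<close>; one more
    cell is added if a white top follows, since the bottom white particle is then reinserted below
    that top.\<close>
  define e where "e = (if fst y = White then Suc (Suc (length v)) else Suc (length v))"
  have arc: "(if fst x = Neutral then on_arc first_to_end (left_cell (length z + 2 + length v) i) (Suc e) (snd (cfg cs))
      else on_arc first_to_end i e (snd (cfg cs))) = map snd cs'"
    using x
  proof (cases rule: split_col_cases)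
    case 1
    have b1: "snd (cfg cs) = map snd z @ (White # Neutral # map snd v)" unfolding b using 1 by simp
    \<comment> \<open>For neutral \<open>y\<close> the arc ends exactly at the cut. Otherwise it
      wraps by one cell: the bottom particle \<open>q\<close> of \<open>y\<close> becomes the last
      entry, and the travelling white one the first.\<close>
    have "on_arc first_to_end (length (map snd z)) (Suc e) (map snd z @ (White # Neutral # map snd v)) = map snd cs'"
      using y
    proof (cases rule: split_col_cases)
      case y: 1
      show ?thesis
        by (rule trans[OF on_arc_split[where A = "Neutral # map snd v @ [White]" and B = "map snd z"]])
          (use y 1 zxb in \<open>auto simp: e_def first_to_end_def cs'\<close>)
    next
      case y: (2 q)
      then obtain z' where z: "z = y # z'" "w = z' @ [x]" using zx 1 by (cases z) auto
      show ?thesis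
        by (rule trans[OF on_arc_split[where A = "Neutral # map snd v @ [q]" and B = "White # map snd z'"]])
          (use y 1 z in \<open>auto simp: e_def first_to_end_def cs'\<close>)
    qed
    then show ?thesis using 1 lc b1 by simp
  next
    case (2 p)
    have b2: "snd (cfg cs) = (map snd z @ [p]) @ (White # map snd v)" unfolding b using 2 by simp
    have zp: "map snd z @ [p] = snd y # map snd w" using zxb 2 by simp
    have "on_arc first_to_end (length (map snd z @ [p])) e ((map snd z @ [p]) @ (White # map snd v)) = map snd cs'"
      using y
    proof (cases rule: split_col_cases)
      case y: 1
      show ?thesis unfolding zp
        by (rule trans[OF on_arc_split[where A = "map snd v @ [White]" and B = "snd y # map snd w"]])
          (use y in \<open>auto simp: e_def first_to_end_def cs'\<close>)
    next
      case y: (2 q)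
      show ?thesis unfolding zp
        by (rule trans[OF on_arc_split[where A = "map snd v @ [q]" and B = "White # map snd w"]])
          (use y in \<open>auto simp: e_def first_to_end_def cs'\<close>)
    qed
    then show ?thesis using 2 b2 i by simp
  qed
  have top: "fst y # map fst w @ ?vt @ [Black] = map fst cs'"
    using y by (cases rule: split_col_cases) (auto simp: cs')
  have E: "(if swap_at i (fst (cfg cs)) ! 0 = White then Suc (length v) + 1 else Suc (length v)) = e"
    by (simp add: t0 e_def)
  have "move i (cfg cs) = (swap_at i (fst (cfg cs)), map snd cs')"
    unfolding move_def Let_def if_not_P[OF nw]
    unfolding run fin E ti unfolding n(1) by (simp only: arc[unfolded Suc_eq_plus1])
  then show "move i (cfg cs) = cfg cs'"
    unfolding t' eq_t top by (simp add: cfg_def)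
qed

section \<open>Weight times rate of a move\<close>

definition pair_prob :: "real \<Rightarrow> real \<Rightarrow> real \<Rightarrow> particle \<Rightarrow> particle \<Rightarrow> real" where
  "pair_prob \<alpha> \<beta> \<gamma> a b =
     (if (a, b) = (Black, White) then \<alpha> else if (a, b) = (Neutral, White) then \<beta>
      else if (a, b) = (Black, Neutral) then \<gamma> else 0)"

lemma swap_prob_pair: "swap_prob \<alpha> \<beta> \<gamma> t i = pair_prob \<alpha> \<beta> \<gamma> (t ! left_cell (length t) i) (t ! i)"
  by (simp add: swap_prob_def pair_prob_def Let_def)

lemma swap_prob_append:
  "swap_prob \<alpha> \<beta> \<gamma> (p @ a # b # q) (Suc (length p)) = pair_prob \<alpha> \<beta> \<gamma> a b"
  by (simp add: swap_prob_pair left_cell_Suc nth_append)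

lemma swap_prob_0: "t \<noteq> [] \<Longrightarrow> swap_prob \<alpha> \<beta> \<gamma> t 0 = pair_prob \<alpha> \<beta> \<gamma> (last t) (hd t)"
  by (simp add: swap_prob_pair left_cell_def last_conv_nth hd_conv_nth)

abbreviation rate :: "real \<Rightarrow> real \<Rightarrow> real \<Rightarrow> column list \<Rightarrow> nat \<Rightarrow> real" where
  "rate \<alpha> \<beta> \<gamma> cs i \<equiv> swap_prob \<alpha> \<beta> \<gamma> (map fst cs) i"

text \<open>The factor depending on the number of columns is left out, so that circles of different
  sizes can be compared.\<close>

definition circ_weight :: "real \<Rightarrow> real \<Rightarrow> real \<Rightarrow> column list \<Rightarrow> real" where
  "circ_weight \<alpha> \<beta> \<gamma> cs = (\<alpha> / \<beta>) ^ circ_sum y_count cs * (\<alpha> / \<gamma>) ^ circ_sum z_count cs"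

lemma circ_weight_append_commute: "circ_weight \<alpha> \<beta> \<gamma> (u @ v) = circ_weight \<alpha> \<beta> \<gamma> (v @ u)"
  by (simp add: circ_weight_def circ_sum_append_commute[of _ u v])

lemma circ_weight_rotate: "circ_weight \<alpha> \<beta> \<gamma> (rotate s cs) = circ_weight \<alpha> \<beta> \<gamma> cs"
  by (simp add: circ_weight_def)

lemma proper_set: "set cs = set ds \<Longrightarrow> proper cs \<longleftrightarrow> proper ds"
  by (simp add: proper_def)

lemma admissible_append_commute: "admissible (u @ v) \<longleftrightarrow> admissible (v @ u)"
  unfolding admissible_def circ_sum_append_commute[of _ u v]
  using proper_set[of "u @ v" "v @ u"] by auto

lemma admissible_rotate: "admissible (rotate s cs) \<longleftrightarrow> admissible cs"
  unfolding admissible_def using proper_set[of "rotate s cs" cs] by simp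

text \<open>The label created at a neutral \<open>x\<close> brings the factor
  \<open>\<alpha> / \<beta>\<close>, which turns the rate \<open>\<beta>\<close> into
  \<open>\<alpha>\<close>.\<close>

lemma circ_weight_insert_WB:
  assumes "admissible (x # R)" "fst x \<noteq> White" "\<beta> \<noteq> 0"
  shows "circ_weight \<alpha> \<beta> \<gamma> (x # (White, Black) # R) * (if x = neutral then \<beta> else \<alpha>)
       = \<alpha> * circ_weight \<alpha> \<beta> \<gamma> (x # R)"
proof -
  have "proper (x # R)" using assms by (simp add: admissible_def)
  from circ_insert_WB(2,3)[OF this assms(2,1)] show ?thesis
    using assms(3) by (simp add: circ_weight_def)
qed

lemma circ_weight_split_col:
  assumes "admissible (x # R)" "fst x \<noteq> Black" "\<gamma> \<noteq> 0"
  shows "circ_weight \<alpha> \<beta> \<gamma> (split_col x @ R) * (if x = neutral then \<gamma> else \<alpha>)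
       = \<alpha> * circ_weight \<alpha> \<beta> \<gamma> (x # R)"
proof -
  have "proper (x # R)" using assms by (simp add: admissible_def)
  from circ_split_col(2,3)[OF this assms(2,1)] show ?thesis
    using assms(3) by (simp add: circ_weight_def)
qed

lemma proper_neutral: "proper cs \<Longrightarrow> c \<in> set cs \<Longrightarrow> fst c = Neutral \<longleftrightarrow> c = neutral"
  by (cases c) (auto simp: proper_def)

lemma pair_prob_simps:
  "a \<noteq> White \<Longrightarrow> pair_prob \<alpha> \<beta> \<gamma> a White = (if a = Neutral then \<beta> else \<alpha>)"
  "b \<noteq> Black \<Longrightarrow> pair_prob \<alpha> \<beta> \<gamma> Black b = (if b = Neutral then \<gamma> else \<alpha>)"
  by (cases a; simp add: pair_prob_def) (cases b; simp add: pair_prob_def)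

lemma white_move_balance:
  assumes m: "white_move cs i cs'" and ad: "admissible cs" and pos: "0 < \<alpha>" "0 < \<beta>" "0 < \<gamma>"
  shows "admissible cs'" "mset (map fst cs') = mset (map fst cs)"
    and "circ_weight \<alpha> \<beta> \<gamma> cs' * rate \<alpha> \<beta> \<gamma> cs' 0 = circ_weight \<alpha> \<beta> \<gamma> cs * rate \<alpha> \<beta> \<gamma> cs i"
    and "rate \<alpha> \<beta> \<gamma> cs' 0 \<noteq> 0"
proof -
  obtain u x v where cs: "cs = u @ x # (White, Black) # v" and i: "i = Suc (length u)"
     and cs': "cs' = (White, Black) # u @ x # v" and u: "\<forall>c\<in>set u. fst c = White"
     and x: "fst x \<noteq> White" "fst (last (x # v)) \<noteq> White"
    using m unfolding white_move_def by blast
  \<comment> \<open>The circle without the travelling column. It is rotated to start with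
    \<open>x\<close> for the departure, and with its last column \<open>l\<close> for the
    arrival.\<close>
  define B where "B = u @ x # v"
  define l where "l = last B"
  define B0 where "B0 = butlast B"
  have "B \<noteq> []" by (simp add: B_def)
  then have B: "B = B0 @ [l]" by (simp add: l_def B0_def)
  have l: "fst l \<noteq> White" using x(2) by (simp add: l_def B_def split: if_splits)
  have pcs: "proper cs" using ad by (simp add: admissible_def)
  then have pB: "proper B" by (auto simp: proper_def cs B_def)
  have xn: "fst x = Neutral \<longleftrightarrow> x = neutral" and ln: "fst l = Neutral \<longleftrightarrow> l = neutral"
    using proper_neutral[OF pB] by (auto simp: B_def l_def)
  have p1: "proper (x # v @ u)"
    using pB proper_set[of B "x # v @ u"] by (simp add: B_def Un_commute)
  have "set (l # B0) = set B" by (simp add: B)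
  then have p2: "proper (l # B0)" using pB proper_set by blast
  have "admissible (x # (White, Black) # v @ u)" using ad admissible_append_commute[of u] by (simp add: cs)
  then have a1: "admissible (x # v @ u)" using circ_insert_WB(1)[OF p1 x(1)] by simp
  then have "admissible B" using admissible_append_commute[of u "x # v"] by (simp add: B_def)
  then have a2: "admissible (l # B0)" using admissible_append_commute[of B0 "[l]"] by (simp add: B)
  then have "admissible (l # (White, Black) # B0)" using circ_insert_WB(1)[OF p2 l] by simp
  then show "admissible cs'"
    using admissible_append_commute[of "(White, Black) # B0" "[l]"] B by (simp add: cs' B_def)
  show "mset (map fst cs') = mset (map fst cs)" by (simp add: cs cs')
  have r1: "rate \<alpha> \<beta> \<gamma> cs i = (if x = neutral then \<beta> else \<alpha>)"
    using swap_prob_append[of \<alpha> \<beta> \<gamma> "map fst u" "fst x" White "map fst v"] x(1) xn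
    by (simp add: cs i pair_prob_simps)
  have cs'_l: "cs' = (White, Black) # B0 @ [l]" using B by (simp add: cs' B_def)
  then have r2: "rate \<alpha> \<beta> \<gamma> cs' 0 = (if l = neutral then \<beta> else \<alpha>)"
    using l ln by (simp add: swap_prob_0 pair_prob_simps)
  show "rate \<alpha> \<beta> \<gamma> cs' 0 \<noteq> 0" using r2 pos by simp
  have "circ_weight \<alpha> \<beta> \<gamma> cs * rate \<alpha> \<beta> \<gamma> cs i = \<alpha> * circ_weight \<alpha> \<beta> \<gamma> B"
    using circ_weight_insert_WB[OF a1 x(1), of \<beta> \<alpha> \<gamma>] pos r1
      circ_weight_append_commute[of _ _ _ u] by (simp add: cs B_def)
  moreover have "circ_weight \<alpha> \<beta> \<gamma> cs' * rate \<alpha> \<beta> \<gamma> cs' 0 = \<alpha> * circ_weight \<alpha> \<beta> \<gamma> B"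
    using circ_weight_insert_WB[OF a2 l, of \<beta> \<alpha> \<gamma>] pos r2 cs'_l
      circ_weight_append_commute[of \<alpha> \<beta> \<gamma> "(White, Black) # B0" "[l]"]
      circ_weight_append_commute[of \<alpha> \<beta> \<gamma> B0 "[l]"] by (simp add: B)
  ultimately show "circ_weight \<alpha> \<beta> \<gamma> cs' * rate \<alpha> \<beta> \<gamma> cs' 0 = circ_weight \<alpha> \<beta> \<gamma> cs * rate \<alpha> \<beta> \<gamma> cs i"
    by simp
qed

lemma proper_split_col:
  assumes "proper (split_col x @ R)" "x = neutral \<or> fst x = White"
  shows "proper (x # R)"
  using assms(2,1) by (cases rule: split_col_cases) (auto simp: proper_def)

lemma black_move_balance:
  assumes m: "black_move cs i cs'" and ad: "admissible cs" and pos: "0 < \<alpha>" "0 < \<beta>" "0 < \<gamma>"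
  shows "admissible cs'" "mset (map fst cs') = mset (map fst cs)"
    and "circ_weight \<alpha> \<beta> \<gamma> cs' * rate \<alpha> \<beta> \<gamma> cs' 0 = circ_weight \<alpha> \<beta> \<gamma> cs * rate \<alpha> \<beta> \<gamma> cs i"
    and "rate \<alpha> \<beta> \<gamma> cs' 0 \<noteq> 0"
proof -
  obtain z x v y w where cs: "cs = z @ split_col x @ v" and i: "i = Suc (length z)" and zx: "z @ [x] = y # w"
     and cs': "cs' = tl (split_col y) @ w @ v @ [hd (split_col y)]" and v: "\<forall>c\<in>set v. fst c = Black"
     and x: "x = neutral \<or> fst x = White" and y: "y = neutral \<or> fst y = White"
    using m unfolding black_move_def by blast
  have xb: "fst x \<noteq> Black" and yb: "fst y \<noteq> Black" using x y by auto
  \<comment> \<open>The smaller circle, read in two ways: \<open>cs\<close> splits its column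
    \<open>x\<close>, and \<open>cs'\<close> splits its column \<open>y\<close> with the cut between
    the two halves.\<close>
  have zxv: "z @ x # v = y # w @ v" using zx by (metis append.assoc append_Cons append_Nil)
  have ad1: "admissible (split_col x @ v @ z)"
    using ad admissible_append_commute[of z "split_col x @ v"] by (simp add: cs)
  then have p1: "proper (x # v @ z)" using proper_split_col x by (simp add: admissible_def)
  have a1: "admissible (x # v @ z)" using circ_split_col(1)[OF p1 xb] ad1 by simp
  then have a2: "admissible (y # w @ v)" using admissible_append_commute[of z "x # v"] zxv by simp
  then have p2: "proper (y # w @ v)" by (simp add: admissible_def)
  have cy: "hd (split_col y) # tl (split_col y) = split_col y" by (simp add: split_col_def)
  have "admissible (split_col y @ w @ v)" using circ_split_col(1)[OF p2 yb] a2 by simp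
  then show "admissible cs'"
    using admissible_append_commute[of "tl (split_col y) @ w @ v" "[hd (split_col y)]"] cy
    by (simp add: cs') (metis append_Cons)
  have tx: "map fst (split_col x) = [Black, fst x]" and ty: "map fst (split_col y) = [Black, fst y]"
    using x y by (auto simp: split_col_def)
  have ty': "map fst (tl (split_col y)) = [fst y]" "fst (hd (split_col y)) = Black"
    using ty cy by (simp_all add: map_tl) (metis list.sel(1) list.simps(9))
  have "mset (map fst z) + {#fst x#} = {#fst y#} + mset (map fst w)"
    using arg_cong[OF zx, of "\<lambda>l. mset (map fst l)"] by simp
  then show "mset (map fst cs') = mset (map fst cs)"
    using tx ty' by (simp add: cs cs' ac_simps)
  have r1: "rate \<alpha> \<beta> \<gamma> cs i = (if x = neutral then \<gamma> else \<alpha>)"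
    using swap_prob_append[of \<alpha> \<beta> \<gamma> "map fst z" Black "fst x" "map fst v"] x
    by (auto simp: cs tx i pair_prob_simps)
  have r2: "rate \<alpha> \<beta> \<gamma> cs' 0 = (if y = neutral then \<gamma> else \<alpha>)"
    using y ty' by (subst swap_prob_0) (auto simp: cs' pair_prob_simps)
  show "rate \<alpha> \<beta> \<gamma> cs' 0 \<noteq> 0" using r2 pos by simp
  have "circ_weight \<alpha> \<beta> \<gamma> cs * rate \<alpha> \<beta> \<gamma> cs i = \<alpha> * circ_weight \<alpha> \<beta> \<gamma> (x # v @ z)"
    using circ_weight_split_col[OF a1 xb, of \<gamma> \<alpha> \<beta>] pos r1
      circ_weight_append_commute[of \<alpha> \<beta> \<gamma> z "split_col x @ v"] by (simp add: cs)
  moreover have "circ_weight \<alpha> \<beta> \<gamma> (x # v @ z) = circ_weight \<alpha> \<beta> \<gamma> (y # w @ v)"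
    using circ_weight_append_commute[of \<alpha> \<beta> \<gamma> z "x # v"] zxv by simp
  moreover have "circ_weight \<alpha> \<beta> \<gamma> cs' = circ_weight \<alpha> \<beta> \<gamma> (split_col y @ w @ v)"
    using circ_weight_append_commute[of \<alpha> \<beta> \<gamma> "tl (split_col y) @ w @ v" "[hd (split_col y)]"] cy
    by (simp add: cs') (metis append_Cons)
  moreover note circ_weight_split_col[OF a2 yb, of \<gamma> \<alpha> \<beta>]
  ultimately show "circ_weight \<alpha> \<beta> \<gamma> cs' * rate \<alpha> \<beta> \<gamma> cs' 0 = circ_weight \<alpha> \<beta> \<gamma> cs * rate \<alpha> \<beta> \<gamma> cs i"
    using r2 pos by simp
qed

section \<open>Normal forms of triggered walls\<close>

text \<open>Cyclically this column opens a word, and two white particles there would violate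
  positivity. So white behind neutral is always a white-over-black column.\<close>

lemma admissible_after_neutral:
  assumes "admissible ((White, q) # D @ [neutral])" shows "q = Black"
proof -
  have p: "proper ((White, q) # D @ [neutral])" using assms by (simp add: admissible_def)
  have "neutral \<in> set (D @ [neutral])" by simp
  from circ_sum_slot[OF this] obtain b Q where b: "neutral \<notin> set b" "set b \<subseteq> set (D @ [neutral])"
     "\<And>g c. neutral \<notin> set c \<Longrightarrow> circ_sum g (c @ D @ [neutral]) = g (c @ b) + lin_sum g Q"
    by (metis append_Nil last_snoc)
  have "circ_sum defects ((White, q) # D @ [neutral]) = defects ((White, q) # b) + lin_sum defects Q"
    using b(3)[of "[(White, q)]" defects] by simp
  then have "defects ((White, q) # b) = 0" using assms by (simp add: admissible_def)
  moreover have "set ((White, q) # b) \<subseteq> {Black, White} \<times> {Black, White}"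
    by (rule proper_word[OF p]) (use b in auto)
  ultimately have "word ((White, q) # b)" using defects_word by (metis zero_neq_one)
  then show ?thesis by (cases rule: word_Cons_cases) auto
qed

text \<open>Cyclically this column closes a word, and two black particles there would leave a prefix
  of negative excess.\<close>

lemma admissible_before_neutral:
  assumes "admissible (neutral # D @ [(Black, q)])" shows "q = White"
proof -
  have ad: "admissible ((Black, q) # neutral # D)"
    using assms admissible_append_commute[of "neutral # D" "[(Black, q)]"] by simp
  then have p: "proper ((Black, q) # neutral # D)" by (simp add: admissible_def)
  have "neutral \<in> set (neutral # D)" by simp
  from circ_sum_slot[OF this] obtain a Q where a: "neutral \<notin> set a" "set a \<subseteq> set (neutral # D)"
     "\<And>g c. neutral \<notin> set c \<Longrightarrow> circ_sum g (c @ neutral # D) = g (a @ c) + lin_sum g Q"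
    by (metis append_Nil2 list.sel(1))
  have "circ_sum defects ((Black, q) # neutral # D) = defects (a @ [(Black, q)]) + lin_sum defects Q"
    using a(3)[of "[(Black, q)]" defects] by simp
  then have "defects (a @ [(Black, q)]) = 0" using ad by (simp add: admissible_def)
  moreover have s: "set (a @ [(Black, q)]) \<subseteq> {Black, White} \<times> {Black, White}"
    by (rule proper_word[OF p]) (use a in auto)
  ultimately have w: "word (a @ [(Black, q)])" using defects_word by (metis zero_neq_one)
  then have "0 \<le> excess a" "excess (a @ [(Black, q)]) = 0" unfolding word_iff by blast+
  then show ?thesis using s by (auto split: if_splits)
qed

lemma triggered_normal_form:
  assumes ad: "admissible cs" and i: "i < length cs" and tr: "rate \<alpha> \<beta> \<gamma> cs i \<noteq> 0"
  shows "\<exists>s i0 cs'. s < length cs \<and> i0 < length cs \<and> i = (i0 + s) mod length cs \<and>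
     (white_move (rotate s cs) i0 cs' \<or> black_move (rotate s cs) i0 cs')"
proof -
  let ?n = "length cs"
  let ?t = "map fst cs"
  have pp: "pair_prob \<alpha> \<beta> \<gamma> (?t ! left_cell ?n i) (?t ! i) \<noteq> 0" using tr by (simp add: swap_prob_pair)
  then have "?t ! left_cell ?n i \<noteq> ?t ! i" by (auto simp: pair_prob_def split: if_splits)
  then have "left_cell ?n i \<noteq> i" by metis
  \<comment> \<open>The particles on the two sides of a triggered wall differ, so the wall does not
    separate a cell from itself.\<close>
  then have n2: "2 \<le> ?n" using i by (cases cs; cases "tl cs") (auto simp: left_cell_def)
  have ne: "cs \<noteq> []" using i by auto
  define R where "R = rotate i cs"
  have lR: "length R = ?n" by (simp add: R_def)
  obtain c2 D c1 where R: "R = c2 # D @ [c1]"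
  proof -
    obtain c2 R' where R': "R = c2 # R'" using lR n2 by (cases R) auto
    then have "R' \<noteq> []" using lR n2 by auto
    then obtain D c1 where "R' = D @ [c1]" by (metis rev_exhaust)
    then show ?thesis using that R' by blast
  qed
  have "R ! 0 = cs ! i" using i ne by (simp add: R_def nth_rotate)
  then have c2: "fst c2 = ?t ! i" using R i by simp
  have "R ! (?n - 1) = cs ! left_cell ?n i" using i ne by (simp add: R_def nth_rotate left_cell_def)
  then have "last R = cs ! left_cell ?n i" 
    using last_conv_nth[of R] lR by (metis One_nat_def R list.distinct(1))
  then have c1: "fst c1 = ?t ! left_cell ?n i" using R ne by simp
  have adR: "admissible (c2 # D @ [c1])" using ad admissible_rotate[of i cs] R by (simp add: R_def)
  then have pR: "proper (c2 # D @ [c1])" by (simp add: admissible_def)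
  \<comment> \<open>The circle is first opened at the wall itself, then cut again at a wall inside
    \<open>D\<close>, the end of the run still to be chosen.\<close>
  have cut: ?thesis
    if "D = v @ u" and "white_move (u @ c1 # c2 # v) (Suc (length u)) cs' \<or>
       black_move (u @ c1 # c2 # v) (Suc (length u)) cs'" for u v cs'
  proof -
    let ?s = "(i + Suc (length v)) mod ?n"
    have n: "?n = length u + length v + 2" using lR R that(1) by simp
    have "rotate (Suc (length v)) R = u @ c1 # c2 # v"
      using R that(1) rotate_append[of "c2 # v" "u @ [c1]"] by simp
    moreover have "rotate (Suc (length v)) R = rotate ?s cs"
      using rotate_conv_mod[of "i + Suc (length v)" cs] by (simp add: R_def rotate_rotate add.commute)
    moreover have "(Suc (length u) + ?s) mod ?n = i"
    proof -
      have "(Suc (length u) + ?s) mod ?n = (i + ?n) mod ?n"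
        using mod_add_right_eq[of "Suc (length u)" "i + Suc (length v)" ?n] n by (simp add: ac_simps)
      then show ?thesis using i by simp
    qed
    moreover have "?s < ?n" "Suc (length u) < ?n" using i n by (auto intro: mod_less_divisor)
    ultimately show ?thesis using that(2) by metis
  qed
  show ?thesis
  proof (cases "c2 = (White, Black)")
    case True
    let ?P = "\<lambda>c :: column. fst c = White"
    \<comment> \<open>After the swap the white particle takes the place of the top of
      \<open>c1\<close>, so its run continues into the end of \<open>D\<close>.\<close>
    define u where "u = rev (takeWhile ?P (rev D))"
    define v where "v = rev (dropWhile ?P (rev D))"
    have D: "D = v @ u" by (metis u_def v_def rev_append rev_rev_ident takeWhile_dropWhile_id)
    have c1w: "fst c1 \<noteq> White" using pp c1 by (auto simp: pair_prob_def split: if_splits)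
    have "\<not> ?P (last v)" if "v \<noteq> []"
      using that hd_dropWhile[of ?P "rev D"] by (simp add: v_def last_rev)
    then have "fst (last (c1 # v)) \<noteq> White" using c1w by simp
    moreover have "\<forall>c\<in>set u. fst c = White" by (auto simp: u_def dest: set_takeWhileD)
    ultimately have "white_move (u @ c1 # c2 # v) (Suc (length u)) ((White, Black) # u @ c1 # v)"
      using c1w True unfolding white_move_def by blast
    then show ?thesis using cut D by blast
  next
    case False
    \<comment> \<open>The two columns at the wall merge into \<open>x\<close>. White behind neutral
      would force \<open>c2 = (White, Black)\<close>, which this case excludes.\<close>
    obtain x where x: "x = neutral \<or> fst x = White" "split_col x = [c1, c2]"
    proof -
      obtain p1 q1 p2 q2 where pq: "c1 = (p1, q1)" "c2 = (p2, q2)" by fastforce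
      have nn: "p1 = Neutral \<longleftrightarrow> q1 = Neutral" "p2 = Neutral \<longleftrightarrow> q2 = Neutral"
        using pR pq by (auto simp: proper_def)
      consider "p1 = Black" "p2 = White" | "p1 = Neutral" "p2 = White" | "p1 = Black" "p2 = Neutral"
        using pp c1 c2 pq by (auto simp: pair_prob_def split: if_splits)
      then show ?thesis
      proof cases
        case 1
        then have "q2 = White" using False pq nn by (cases q2) auto
        then show ?thesis using that[of "(White, q1)"] 1 pq by (simp add: split_col_def)
      next
        case 2
        then have "q2 = Black" using admissible_after_neutral[of q2 D] adR pq nn by simp
        then show ?thesis using False pq 2 by simp
      next
        case 3
        then have "q1 = White" using admissible_before_neutral[of D q1] adR pq nn by simp
        then show ?thesis using that[of neutral] 3 pq nn by (simp add: split_col_def)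
      qed
    qed
    let ?P = "\<lambda>c :: column. fst c = Black"
    define v where "v = takeWhile ?P D"
    define z where "z = dropWhile ?P D"
    have D: "D = v @ z" by (simp add: v_def z_def)
    obtain y w where yw: "z @ [x] = y # w" by (cases z) auto
    have "y = neutral \<or> fst y = White"
    proof (cases z)
      case Nil
      then show ?thesis using yw x by simp
    next
      case (Cons d z')
      then have "y = d" using yw by simp
      moreover have "fst d \<noteq> Black" using hd_dropWhile[of ?P D, folded z_def, unfolded Cons] by simp
      moreover have "d \<in> set (c2 # D @ [c1])" using D Cons by simp
      ultimately show ?thesis using proper_neutral[OF pR, of d] by (cases "fst d") auto
    qed
    moreover have "\<forall>c\<in>set v. fst c = Black" by (auto simp: v_def dest: set_takeWhileD)
    moreover have "z @ c1 # c2 # v = z @ split_col x @ v" using x by simp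
    ultimately have "black_move (z @ c1 # c2 # v) (Suc (length z))
        (tl (split_col y) @ w @ v @ [hd (split_col y)])"
      using x(1) yw unfolding black_move_def by blast
    then show ?thesis using cut D by blast
  qed
qed

text \<open>On the suitably cut circle the jump is 0, so by equivariance the amount of rotation is
  the jump on the original circle.\<close>

lemma move_normal_form:
  assumes ad: "admissible cs" and i: "i < length cs" and tr: "rate \<alpha> \<beta> \<gamma> cs i \<noteq> 0"
    and j: "j = jump i (cfg cs)"
  shows "j < length cs \<and> (\<exists>i0 cs'. i0 < length cs \<and> i = (i0 + j) mod length cs \<and>
     (white_move (rotate j cs) i0 cs' \<or> black_move (rotate j cs) i0 cs') \<and>
     rot j (move i (cfg cs)) = cfg cs')"
proof -
  let ?n = "length cs"
  obtain s i0 cs' where s: "s < ?n" and i0: "i0 < ?n" and k: "i = (i0 + s) mod ?n"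
     and m: "white_move (rotate s cs) i0 cs' \<or> black_move (rotate s cs) i0 cs'"
    using triggered_normal_form[OF ad i tr] by blast
  have len: "length (fst (cfg cs)) = ?n" "length (snd (cfg cs)) = ?n" by (simp_all add: cfg_def)
  have lc: "left_cell ?n i0 < ?n" using i0 by (intro left_cell_less) linarith
  have nth: "fst (cfg (rotate s cs)) ! i0 = fst (cfg cs) ! i" "snd (cfg (rotate s cs)) ! i0 = snd (cfg cs) ! i"
    "fst (cfg (rotate s cs)) ! left_cell ?n i0 = fst (cfg cs) ! left_cell ?n i"
    using i0 i lc k len
    by (auto simp: cfg_rotate rot_def nth_rotate' left_cell_add)
  have M: "move i0 (cfg (rotate s cs)) = cfg cs'" "jump i0 (cfg (rotate s cs)) = 0"
     "fst (cfg cs) ! i = White \<and> snd (cfg cs) ! i = Black \<or> fst (cfg cs) ! left_cell ?n i = Black"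
    using m white_move_move[of "rotate s cs" i0 cs'] black_move_move[of "rotate s cs" i0 cs'] nth by auto
  have "rot s (move i (cfg cs)) = cfg cs'" "(0 + s) mod ?n = jump i (cfg cs)"
    using move_jump_rotate[OF len i0 k] M by (auto simp: cfg_rotate)
  then have "j = s" "rot s (move i (cfg cs)) = cfg cs'" using s j by auto
  then show ?thesis using s i0 k m by blast
qed

lemma mset_rotate: "mset (rotate s xs) = mset xs"
proof (induction s)
  case (Suc s)
  have "mset (rotate1 ys) = mset ys" for ys :: "'a list" by (cases ys) simp_all
  then show ?case using Suc by simp
qed simp

lemma rot_rot: "rot r (rot s \<omega>) = rot (r + s) \<omega>"
  by (simp add: rot_def rotate_rotate)

text \<open>The non-zero rate at \<open>j\<close> says that the image pair is triggered again, which
  makes the moves a self-map of the triggered pairs.\<close>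

lemma move_balance:
  assumes ad: "admissible cs" and i: "i < length cs" and tr: "rate \<alpha> \<beta> \<gamma> cs i \<noteq> 0"
    and pos: "0 < \<alpha>" "0 < \<beta>" "0 < \<gamma>" and j: "j = jump i (cfg cs)"
  shows "\<exists>ds. move i (cfg cs) = cfg ds \<and> admissible ds \<and> mset (map fst ds) = mset (map fst cs) \<and>
     j < length cs \<and> rate \<alpha> \<beta> \<gamma> ds j \<noteq> 0 \<and>
     circ_weight \<alpha> \<beta> \<gamma> ds * rate \<alpha> \<beta> \<gamma> ds j = circ_weight \<alpha> \<beta> \<gamma> cs * rate \<alpha> \<beta> \<gamma> cs i"
proof -
  let ?n = "length cs"
  obtain i0 cs' where jn: "j < ?n" and i0: "i0 < ?n" and k: "i = (i0 + j) mod ?n"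
     and m: "white_move (rotate j cs) i0 cs' \<or> black_move (rotate j cs) i0 cs'"
     and mv: "rot j (move i (cfg cs)) = cfg cs'"
    using move_normal_form[OF ad i tr j] by blast
  have ad': "admissible (rotate j cs)" using ad by (simp add: admissible_rotate)
  have B: "admissible cs'" "mset (map fst cs') = mset (map fst (rotate j cs))"
    "circ_weight \<alpha> \<beta> \<gamma> cs' * rate \<alpha> \<beta> \<gamma> cs' 0 = circ_weight \<alpha> \<beta> \<gamma> (rotate j cs) * rate \<alpha> \<beta> \<gamma> (rotate j cs) i0"
    "rate \<alpha> \<beta> \<gamma> cs' 0 \<noteq> 0"
    using m white_move_balance[OF _ ad' pos] black_move_balance[OF _ ad' pos] by blast+
  have n': "length cs' = ?n" using arg_cong[OF B(2), of size] by simp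
  define ds where "ds = rotate (?n - j) cs'"
  have ds: "rotate j ds = cs'" using n' jn by (simp add: ds_def rotate_rotate)
  have ml: "length (fst (move i (cfg cs))) = ?n" "length (snd (move i (cfg cs))) = ?n"
    using arg_cong[OF mv, of "length \<circ> fst"] arg_cong[OF mv, of "length \<circ> snd"] n'
    by (simp_all add: rot_def cfg_def)
  have "cfg ds = rot (?n - j) (rot j (move i (cfg cs)))" by (simp add: mv ds_def cfg_rotate)
  also have "\<dots> = move i (cfg cs)" using jn ml by (simp add: rot_rot) (simp add: rot_def)
  finally have "move i (cfg cs) = cfg ds" ..
  moreover have "rate \<alpha> \<beta> \<gamma> cs' 0 = rate \<alpha> \<beta> \<gamma> ds j"
  proof -
    have "rotate j (map fst ds) = map fst cs'" "length ds = length cs"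
      using ds by (simp add: rotate_map) (simp add: ds_def n')
    then show ?thesis using swap_prob_rotate[of 0 "map fst ds" \<alpha> \<beta> \<gamma> j] jn by fastforce
  qed
  moreover have "rate \<alpha> \<beta> \<gamma> (rotate j cs) i0 = rate \<alpha> \<beta> \<gamma> cs i"
    using swap_prob_rotate[of i0 "map fst cs" \<alpha> \<beta> \<gamma> j] i0 k by (simp add: rotate_map)
  moreover have "admissible ds" "circ_weight \<alpha> \<beta> \<gamma> ds = circ_weight \<alpha> \<beta> \<gamma> cs'"
    "mset (map fst ds) = mset (map fst cs)"
    using B(1,2) by (simp_all add: ds_def admissible_rotate circ_weight_rotate mset_rotate)
  ultimately show ?thesis using B jn by (intro exI[of _ ds]) (simp add: circ_weight_rotate)
qed

text \<open>Equal jumps mean equal cuts. The two normal forms then have the same result, which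
  determines the kind of move and its origin.\<close>

lemma move_jump_inj:
  assumes "admissible cs" "i < length cs" "rate \<alpha> \<beta> \<gamma> cs i \<noteq> 0"
    and "admissible ds" "k < length ds" "rate \<alpha> \<beta> \<gamma> ds k \<noteq> 0" and len: "length cs = length ds"
    and mv: "move i (cfg cs) = move k (cfg ds)" and j: "jump i (cfg cs) = jump k (cfg ds)"
  shows "cs = ds \<and> i = k"
proof -
  define j where "j = jump i (cfg cs)"
  obtain i0 cs' where jn: "j < length cs" and 1: "i = (i0 + j) mod length cs"
     "white_move (rotate j cs) i0 cs' \<or> black_move (rotate j cs) i0 cs'"
     "rot j (move i (cfg cs)) = cfg cs'"
    using move_normal_form[OF assms(1-3) j_def] by blast
  obtain k0 ds' where 2: "k = (k0 + j) mod length ds"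
     "white_move (rotate j ds) k0 ds' \<or> black_move (rotate j ds) k0 ds'"
     "rot j (move k (cfg ds)) = cfg ds'"
    using move_normal_form[OF assms(4-6), of j] j j_def by auto
  have "cs' = ds'" using 1(3) 2(3) mv by simp
  then have "rotate j cs = rotate j ds \<and> i0 = k0"
    using 1(2) 2(2) white_move_inj black_move_inj white_black_move_disjoint by metis
  moreover have "rotate (length cs - j) (rotate j xs) = xs" if "length xs = length cs" for xs :: "column list"
    using that jn by (simp add: rotate_rotate)
  ultimately show ?thesis using 1 2 len by metis
qed

section \<open>The stationary distribution\<close>

lemma subconfig_cfg:
  "subconfig (cfg cs) p = takeWhile (\<lambda>c. c \<noteq> neutral) (tl (rotate p cs))"
  by (simp add: subconfig_def cfg_def zip_map_fst_snd)

lemma neutral_cells_cfg: "neutral_cells (cfg cs) = {p. p < length cs \<and> cs ! p = neutral}"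
  by (auto simp: neutral_cells_def cfg_def prod_eq_iff)

lemma circ_sum_cfg: "circ_sum g cs = (\<Sum>p\<in>neutral_cells (cfg cs). g (subconfig (cfg cs) p))"
proof -
  have "head_term g (rotate p cs) = (if cs ! p = neutral then g (subconfig (cfg cs) p) else 0)"
    if "p < length cs" for p
  proof -
    have "cs \<noteq> []" using that by auto
    then show ?thesis using that hd_rotate_conv_nth[of cs p] by (simp add: head_term_def subconfig_cfg)
  qed
  then have "circ_sum g cs = (\<Sum>p<length cs. if cs ! p = neutral then g (subconfig (cfg cs) p) else 0)"
    unfolding circ_sum_def by (intro sum.cong) auto
  also have "\<dots> = (\<Sum>p\<in>{p\<in>{..<length cs}. cs ! p = neutral}. g (subconfig (cfg cs) p))"
    by (rule sum.inter_filter[symmetric]) simp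
  finally show ?thesis by (simp add: neutral_cells_cfg)
qed

lemma weight_cfg:
  "weight \<alpha> \<beta> \<gamma> (cfg cs) = \<beta> ^ length cs * \<gamma> ^ length cs * circ_weight \<alpha> \<beta> \<gamma> cs"
  by (simp add: weight_def circ_weight_def circ_sum_cfg n_y_def n_z_def y_count_def z_count_def)
    (simp add: cfg_def)

definition row_mset :: "nat \<Rightarrow> nat \<Rightarrow> nat \<Rightarrow> particle multiset" where
  "row_mset k l m = replicate_mset m White + replicate_mset l Neutral + replicate_mset k Black"

lemma row_mset_iff:
  "mset t = row_mset k l m \<longleftrightarrow>
     count_list t Black = k \<and> count_list t Neutral = l \<and> count_list t White = m"
proof -
  have "mset t = row_mset k l m \<longleftrightarrow> (\<forall>x. count_list t x = count (row_mset k l m) x)"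
    by (simp add: multiset_eq_iff count_mset)
  also have "\<dots> \<longleftrightarrow> count_list t Black = k \<and> count_list t Neutral = l \<and> count_list t White = m"
    using particle.exhaust by (auto simp: row_mset_def)
  finally show ?thesis .
qed

lemma size_row_mset: "size (row_mset k l m) = k + l + m"
  by (simp add: row_mset_def)

text \<open>The neutral column that \<open>proper\<close> demands is supplied by
  \<open>l \<ge> 1\<close>.\<close>

lemma complete_configs_iff:
  assumes "l \<ge> 1"
  shows "\<omega> \<in> complete_configs k l m \<longleftrightarrow>
    (\<exists>cs. \<omega> = cfg cs \<and> mset (map fst cs) = row_mset k l m \<and> admissible cs)"
proof -
  have *: "cfg cs \<in> complete_configs k l m \<longleftrightarrow> mset (map fst cs) = row_mset k l m \<and> admissible cs" for cs
  proof (cases "mset (map fst cs) = row_mset k l m")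
    case True
    have n: "length cs = k + l + m"
      using arg_cong[OF True, of size] by (simp add: size_row_mset)
    have "Neutral \<in> set (map fst cs)"
      using True assms by (metis count_list_0_iff not_one_le_zero row_mset_iff)
    then have "neutral \<in> set cs" if "\<forall>c\<in>set cs. fst c = Neutral \<longleftrightarrow> snd c = Neutral"
      using that by (auto simp: image_iff)
    moreover have "(\<forall>i<k + l + m. map fst cs ! i = Neutral \<longleftrightarrow> map snd cs ! i = Neutral) \<longleftrightarrow>
      (\<forall>c\<in>set cs. fst c = Neutral \<longleftrightarrow> snd c = Neutral)"
      by (auto simp: all_set_conv_all_nth n)
    moreover have "(\<forall>p\<in>neutral_cells (cfg cs). balanced (subconfig (cfg cs) p) \<and> positive (subconfig (cfg cs) p))
       \<longleftrightarrow> circ_sum defects cs = 0"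
    proof -
      have "finite (neutral_cells (cfg cs))" by (simp add: neutral_cells_cfg)
      then show ?thesis unfolding circ_sum_cfg by (auto simp: defects_def)
    qed
    ultimately show ?thesis using True n row_mset_iff[of "map fst cs" k l m]
      by (auto simp: complete_configs_def admissible_def proper_def cfg_def)
  next
    case False
    then show ?thesis using row_mset_iff[of "map fst cs" k l m] by (auto simp: complete_configs_def cfg_def)
  qed
  have "\<exists>cs. \<omega> = cfg cs" if "\<omega> \<in> complete_configs k l m"
  proof -
    obtain t b where w: "\<omega> = (t, b)" by (cases \<omega>)
    then have "length t = length b" using that by (simp add: complete_configs_def)
    then have "\<omega> = cfg (zip t b)" by (simp add: cfg_def w)
    then show ?thesis ..
  qed
  then show ?thesis using * by blast
qed

lemma length_row: "mset t = row_mset k l m \<Longrightarrow> length t = k + l + m"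
  by (metis size_mset size_row_mset)

lemma finite_complete_configs:
  assumes "l \<ge> 1" shows "finite (complete_configs k l m)"
proof -
  let ?A = "{Black, Neutral, White} \<times> {Black, Neutral, White}"
  have "complete_configs k l m \<subseteq> cfg ` {cs. set cs \<subseteq> ?A \<and> length cs = k + l + m}"
  proof
    fix \<omega> assume "\<omega> \<in> complete_configs k l m"
    then obtain cs where cs: "\<omega> = cfg cs" "mset (map fst cs) = row_mset k l m"
      using complete_configs_iff[OF assms] by blast
    have "set cs \<subseteq> ?A" using particle.exhaust by auto
    then show "\<omega> \<in> cfg ` {cs. set cs \<subseteq> ?A \<and> length cs = k + l + m}"
      using cs length_row[OF cs(2)] by auto
  qed
  then show ?thesis by (rule finite_subset) (intro finite_imageI finite_lists_length_eq, simp)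
qed

lemma fst_cfg: "fst (cfg cs) = map fst cs"
  by (simp add: cfg_def)

lemma fst_move: "fst (move i \<omega>) = swap_at i (fst \<omega>)"
  by (simp add: move_def Let_def)

text \<open>A wall can be triggered exactly at a descent of \<open>rank\<close>, so the chain acts
  on top rows by sorting adjacent pairs.\<close>

fun rank :: "particle \<Rightarrow> nat" where
  "rank White = 0" | "rank Neutral = 1" | "rank Black = 2"

lemma inj_rank: "inj rank"
  by (rule injI) (metis rank.simps numeral_eq_one_iff particle.exhaust semiring_norm(85) zero_neq_numeral zero_neq_one)

lemma pmf_bernoulli_if:
  assumes "0 \<le> p" "p \<le> 1"
  shows "pmf (bind_pmf (bernoulli_pmf p) (\<lambda>b. return_pmf (if b then x else y))) z
    = (if x = z then 1 else 0) * p + (if y = z then 1 else 0) * (1 - p)"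
  unfolding pmf_bind integral_bernoulli_pmf[OF assms] by (simp add: pmf_return indicator_def)

locale three_tasep =
  fixes \<alpha> \<beta> \<gamma> :: real and k l m :: nat
  assumes params: "0 < \<alpha>" "\<alpha> \<le> 1" "0 < \<beta>" "\<beta> \<le> 1" "0 < \<gamma>" "\<gamma> \<le> 1" and l: "l \<ge> 1"
begin

abbreviation "\<Omega> \<equiv> complete_configs k l m"
abbreviation "q \<equiv> weight \<alpha> \<beta> \<gamma>"
abbreviation "prob_at \<equiv> \<lambda>\<omega> i. swap_prob \<alpha> \<beta> \<gamma> (fst \<omega>) i"
abbreviation "n \<equiv> k + l + m"

lemma length_config:
  assumes "\<omega> \<in> \<Omega>" shows "length (fst \<omega>) = n"
proof -
  obtain cs where "\<omega> = cfg cs" "mset (map fst cs) = row_mset k l m"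
    using assms complete_configs_iff[OF l] by blast
  then show ?thesis using length_row[of "map fst cs"] by (simp add: fst_cfg)
qed

lemma weight_pos: "0 < q \<omega>"
  using params by (simp add: weight_def)

lemma prob_bounds: "0 \<le> swap_prob \<alpha> \<beta> \<gamma> t i" "swap_prob \<alpha> \<beta> \<gamma> t i \<le> 1"
  using params by (auto simp: swap_prob_def Let_def)

lemma move_config:
  assumes "\<omega> \<in> \<Omega>" "i < n" "prob_at \<omega> i \<noteq> 0"
  shows "move i \<omega> \<in> \<Omega>" "jump i \<omega> < n" "prob_at (move i \<omega>) (jump i \<omega>) \<noteq> 0"
    and "q (move i \<omega>) * prob_at (move i \<omega>) (jump i \<omega>) = q \<omega> * prob_at \<omega> i"
proof -
  obtain cs where cs: "\<omega> = cfg cs" "mset (map fst cs) = row_mset k l m" "admissible cs"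
    using assms(1) complete_configs_iff[OF l] by blast
  have n: "length cs = n" using length_row[OF cs(2)] by simp
  obtain ds where ds: "move i (cfg cs) = cfg ds" "admissible ds" "mset (map fst ds) = mset (map fst cs)"
     "jump i (cfg cs) < length cs" "rate \<alpha> \<beta> \<gamma> ds (jump i (cfg cs)) \<noteq> 0"
     "circ_weight \<alpha> \<beta> \<gamma> ds * rate \<alpha> \<beta> \<gamma> ds (jump i (cfg cs)) = circ_weight \<alpha> \<beta> \<gamma> cs * rate \<alpha> \<beta> \<gamma> cs i"
    using move_balance[OF cs(3), of i \<alpha> \<beta> \<gamma> "jump i (cfg cs)"] assms params cs n
    by (auto simp: fst_cfg)
  have n': "length ds = n" using arg_cong[OF ds(3), of size] n by simp
  show "move i \<omega> \<in> \<Omega>" using complete_configs_iff[OF l] cs ds by metis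
  show "jump i \<omega> < n" "prob_at (move i \<omega>) (jump i \<omega>) \<noteq> 0" using cs ds n by (simp_all add: fst_cfg)
  show "q (move i \<omega>) * prob_at (move i \<omega>) (jump i \<omega>) = q \<omega> * prob_at \<omega> i"
    using cs(1) ds(1,6) n n' by (simp add: weight_cfg fst_cfg mult.assoc)
qed

lemma move_config_inj:
  assumes "\<omega> \<in> \<Omega>" "i < n" "prob_at \<omega> i \<noteq> 0" and "\<omega>' \<in> \<Omega>" "i' < n" "prob_at \<omega>' i' \<noteq> 0"
    and "move i \<omega> = move i' \<omega>'" "jump i \<omega> = jump i' \<omega>'"
  shows "\<omega> = \<omega>' \<and> i = i'"
proof -
  obtain cs ds where cs: "\<omega> = cfg cs" "mset (map fst cs) = row_mset k l m" "admissible cs"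
    and ds: "\<omega>' = cfg ds" "mset (map fst ds) = row_mset k l m" "admissible ds"
    using assms(1,4) complete_configs_iff[OF l] by metis
  have "length cs = n" "length ds = n" using length_row[OF cs(2)] length_row[OF ds(2)] by simp_all
  then show ?thesis using move_jump_inj[OF cs(3) _ _ ds(3), of i \<alpha> \<beta> \<gamma> i'] assms cs ds
    by (auto simp: fst_cfg)
qed

lemma pmf_step:
  assumes "\<omega> \<in> \<Omega>"
  shows "pmf (step \<alpha> \<beta> \<gamma> \<omega>) \<omega>' =
    (\<Sum>i<n. (if move i \<omega> = \<omega>' then 1 else 0) * prob_at \<omega> i
          + (if \<omega> = \<omega>' then 1 else 0) * (1 - prob_at \<omega> i)) / real n"
proof -
  have ne: "{..<n} \<noteq> {}" using l by (auto simp: lessThan_empty_iff)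
  show ?thesis unfolding step_def length_config[OF assms] pmf_bind_pmf_of_set[OF ne finite_lessThan]
    by (simp add: pmf_bernoulli_if prob_bounds)
qed

text \<open>
  The moves permute the triggered pairs (configuration, wall) and preserve weight times rate,
  so the flow into a configuration through triggered moves equals the flow out of it.
\<close>

lemma weight_stationary:
  assumes "\<omega>' \<in> \<Omega>"
  shows "(\<Sum>\<omega>\<in>\<Omega>. q \<omega> * pmf (step \<alpha> \<beta> \<gamma> \<omega>) \<omega>') = q \<omega>'"
proof -
  have fin: "finite \<Omega>" by (rule finite_complete_configs[OF l])
  let ?D = "{(\<omega>, i) \<in> \<Omega> \<times> {..<n}. prob_at \<omega> i \<noteq> 0}"
  let ?T = "\<lambda>(\<omega>, i). (move i \<omega>, jump i \<omega>)"
  let ?f = "\<lambda>(\<omega>, i). if \<omega> = \<omega>' then q \<omega> * prob_at \<omega> i else 0"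
  have finD: "finite ?D" using fin by (intro finite_subset[of ?D "\<Omega> \<times> {..<n}"]) auto
  have "?T ` ?D \<subseteq> ?D" using move_config by auto
  moreover have inj: "inj_on ?T ?D" using move_config_inj by (auto simp: inj_on_def)
  ultimately have T: "?T ` ?D = ?D" using finD endo_inj_surj by blast
  have D: "(\<Sum>(\<omega>, i)\<in>\<Omega> \<times> {..<n}. g \<omega> i) = (\<Sum>(\<omega>, i)\<in>?D. g \<omega> i)"
    if "\<And>\<omega> i. prob_at \<omega> i = 0 \<Longrightarrow> g \<omega> i = 0" for g :: "config \<Rightarrow> nat \<Rightarrow> real"
    using fin that by (intro sum.mono_neutral_right) auto
  have "(\<Sum>\<omega>\<in>\<Omega>. \<Sum>i<n. q \<omega> * ((if move i \<omega> = \<omega>' then 1 else 0) * prob_at \<omega> i))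
      = (\<Sum>(\<omega>, i)\<in>?D. q \<omega> * ((if move i \<omega> = \<omega>' then 1 else 0) * prob_at \<omega> i))"
    unfolding sum.cartesian_product by (rule D) simp
  \<comment> \<open>Weight times rate is carried to the image pair, and arriving in the given
    configuration becomes a condition on that pair alone.\<close>
  also have "\<dots> = (\<Sum>x\<in>?D. ?f (?T x))"
    using move_config(4) by (intro sum.cong) auto
  also have "\<dots> = sum ?f ?D" using sum.reindex[OF inj, of ?f] unfolding T by (simp add: o_def)
  also have "\<dots> = (\<Sum>\<omega>\<in>\<Omega>. \<Sum>i<n. if \<omega> = \<omega>' then q \<omega> * prob_at \<omega> i else 0)"
    unfolding sum.cartesian_product by (rule D[symmetric]) auto
  also have "\<dots> = (\<Sum>\<omega>\<in>\<Omega>. if \<omega> = \<omega>' then \<Sum>i<n. q \<omega> * prob_at \<omega> i else 0)"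
    by (intro sum.cong) auto
  also have "\<dots> = (\<Sum>i<n. q \<omega>' * prob_at \<omega>' i)"
    using fin assms by (simp add: sum.delta)
  finally have 1: "(\<Sum>\<omega>\<in>\<Omega>. \<Sum>i<n. q \<omega> * ((if move i \<omega> = \<omega>' then 1 else 0) * prob_at \<omega> i))
      = (\<Sum>i<n. q \<omega>' * prob_at \<omega>' i)" .
  \<comment> \<open>Idle steps contribute only from the configuration itself.\<close>
  have 2: "(\<Sum>\<omega>\<in>\<Omega>. \<Sum>i<n. q \<omega> * ((if \<omega> = \<omega>' then 1 else 0) * (1 - prob_at \<omega> i)))
      = (\<Sum>i<n. q \<omega>' * (1 - prob_at \<omega>' i))"
  proof -
    have "(\<Sum>\<omega>\<in>\<Omega>. \<Sum>i<n. q \<omega> * ((if \<omega> = \<omega>' then 1 else 0) * (1 - prob_at \<omega> i)))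
      = (\<Sum>\<omega>\<in>\<Omega>. if \<omega> = \<omega>' then \<Sum>i<n. q \<omega> * (1 - prob_at \<omega> i) else 0)"
      by (intro sum.cong) auto
    then show ?thesis using fin assms by (simp add: sum.delta)
  qed
  have "(\<Sum>\<omega>\<in>\<Omega>. q \<omega> * pmf (step \<alpha> \<beta> \<gamma> \<omega>) \<omega>') * real n
     = (\<Sum>\<omega>\<in>\<Omega>. \<Sum>i<n. q \<omega> * ((if move i \<omega> = \<omega>' then 1 else 0) * prob_at \<omega> i
          + (if \<omega> = \<omega>' then 1 else 0) * (1 - prob_at \<omega> i)))"
    unfolding sum_distrib_right
  proof (intro sum.cong refl)
    fix \<omega> assume "\<omega> \<in> \<Omega>"
    then show "q \<omega> * pmf (step \<alpha> \<beta> \<gamma> \<omega>) \<omega>' * real n = (\<Sum>i<n. q \<omega> * ((if move i \<omega> = \<omega>' then 1 else 0) * prob_at \<omega> i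
          + (if \<omega> = \<omega>' then 1 else 0) * (1 - prob_at \<omega> i)))"
      using l by (simp only: pmf_step sum_distrib_left[symmetric]) simp
  qed
  also have "\<dots> = (\<Sum>i<n. q \<omega>' * prob_at \<omega>' i) + (\<Sum>i<n. q \<omega>' * (1 - prob_at \<omega>' i))"
    unfolding 1[symmetric] 2[symmetric] by (simp only: distrib_left sum.distrib)
  also have "\<dots> = (\<Sum>i<n. q \<omega>')"
    unfolding sum.distrib[symmetric] by (simp add: algebra_simps)
  finally show ?thesis using l by simp
qed

lemma step_closed:
  assumes "\<omega> \<in> \<Omega>" shows "set_pmf (step \<alpha> \<beta> \<gamma> \<omega>) \<subseteq> \<Omega>"
proof
  fix \<omega>' assume "\<omega>' \<in> set_pmf (step \<alpha> \<beta> \<gamma> \<omega>)"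
  then have "pmf (step \<alpha> \<beta> \<gamma> \<omega>) \<omega>' \<noteq> 0" by (simp add: set_pmf_iff)
  then have "(\<Sum>i<n. (if move i \<omega> = \<omega>' then 1 else 0) * prob_at \<omega> i
          + (if \<omega> = \<omega>' then 1 else 0) * (1 - prob_at \<omega> i)) \<noteq> 0"
    unfolding pmf_step[OF assms] by (rule contrapos_nn) (simp only: div_0)
  then obtain i where "i < n" "(if move i \<omega> = \<omega>' then 1 else 0) * prob_at \<omega> i
          + (if \<omega> = \<omega>' then 1 else 0) * (1 - prob_at \<omega> i) \<noteq> 0"
    by (rule sum.not_neutral_contains_not_neutral) simp
  then show "\<omega>' \<in> \<Omega>"
    using assms move_config(1)[OF assms, of i] by (auto split: if_splits)
qed

lemma step_terms_nonneg:
  "0 \<le> (if move i \<omega> = \<omega>' then 1 else 0) * prob_at \<omega> i + (if \<omega> = \<omega>' then 1 else 0) * (1 - prob_at \<omega> i)"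
  using prob_bounds by simp

lemma step_reaches:
  assumes "\<omega> \<in> \<Omega>" "i < n"
    and "0 < (if move i \<omega> = \<omega>' then 1 else 0) * prob_at \<omega> i + (if \<omega> = \<omega>' then 1 else 0) * (1 - prob_at \<omega> i)"
  shows "\<omega>' \<in> set_pmf (step \<alpha> \<beta> \<gamma> \<omega>)"
proof -
  have "0 < (\<Sum>i<n. (if move i \<omega> = \<omega>' then 1 else 0) * prob_at \<omega> i
          + (if \<omega> = \<omega>' then 1 else 0) * (1 - prob_at \<omega> i))"
    using assms(2,3) step_terms_nonneg by (intro sum_pos2[of _ i]) auto
  then have "0 < pmf (step \<alpha> \<beta> \<gamma> \<omega>) \<omega>'" using assms l by (simp add: pmf_step)
  then show ?thesis by (simp add: set_pmf_iff)
qed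

section \<open>Reaching one configuration by sorting top rows\<close>

definition row_step :: "(row \<times> row) set" where
  "row_step = {(t, swap_at i t) | t i. i < length t \<and> swap_prob \<alpha> \<beta> \<gamma> t i \<noteq> 0}"

text \<open>The top row of a move does not depend on the bottom row, so paths of rows lift to paths
  of configurations.\<close>

lemma lift_row_steps:
  assumes "(t, t') \<in> row_step\<^sup>*" "\<omega> \<in> \<Omega>" "fst \<omega> = t"
  shows "\<exists>\<omega>'\<in>\<Omega>. fst \<omega>' = t' \<and> (\<omega>, \<omega>') \<in> {(x, y). y \<in> set_pmf (step \<alpha> \<beta> \<gamma> x)}\<^sup>*"
  using assms(1)
proof (induction rule: rtrancl_induct)
  case base
  show ?case using assms(2,3) by blast
next
  case (step y z)
  then obtain \<omega>' where w: "\<omega>' \<in> \<Omega>" "fst \<omega>' = y" "(\<omega>, \<omega>') \<in> {(x, y). y \<in> set_pmf (step \<alpha> \<beta> \<gamma> x)}\<^sup>*"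
    by blast
  obtain i where i: "z = swap_at i y" "i < n" "prob_at \<omega>' i \<noteq> 0"
    using step(2) w length_config[OF w(1)] by (auto simp: row_step_def)
  have "0 < prob_at \<omega>' i" using i(3) prob_bounds(1)[of "fst \<omega>'" i] by linarith
  then have "move i \<omega>' \<in> set_pmf (step \<alpha> \<beta> \<gamma> \<omega>')"
    by (intro step_reaches[OF w(1) i(2)]) (use prob_bounds(2)[of "fst \<omega>'" i] in auto)
  then have "(\<omega>, move i \<omega>') \<in> {(x, y). y \<in> set_pmf (step \<alpha> \<beta> \<gamma> x)}\<^sup>*"
    using w(3) by (auto intro: rtrancl_into_rtrancl)
  moreover have "fst (move i \<omega>') = z" using i w by (simp add: fst_move)
  ultimately show ?case using move_config(1)[OF w(1) i(2,3)] by blast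
qed

text \<open>This makes it possible to sort an arc that crosses the cut of the row.\<close>

lemma row_steps_rotate:
  assumes "(u, u') \<in> row_step\<^sup>*" "u = rotate s t"
  shows "\<exists>t'. u' = rotate s t' \<and> (t, t') \<in> row_step\<^sup>*"
  using assms(1)
proof (induction rule: rtrancl_induct)
  case base
  show ?case using assms(2) by blast
next
  case (step y z)
  then obtain t' where t': "y = rotate s t'" "(t, t') \<in> row_step\<^sup>*" by blast
  obtain i where i: "z = swap_at i y" "i < length y" "swap_prob \<alpha> \<beta> \<gamma> y i \<noteq> 0"
    using step(2) by (auto simp: row_step_def)
  let ?j = "(i + s) mod length t'"
  have il: "i < length t'" using i(2) t'(1) by simp
  then have z: "z = rotate s (swap_at ?j t')" and "swap_prob \<alpha> \<beta> \<gamma> t' ?j \<noteq> 0" "?j < length t'"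
    using i t' swap_at_rotate[OF il, of s] swap_prob_rotate[OF il] by (auto intro: mod_less_divisor)
  then have "(t', swap_at ?j t') \<in> row_step" by (auto simp: row_step_def)
  then show ?case using t'(2) z by (blast intro: rtrancl_into_rtrancl)
qed

lemma pair_prob_rank: "pair_prob \<alpha> \<beta> \<gamma> a b \<noteq> 0 \<longleftrightarrow> rank b < rank a"
  using params by (cases a; cases b) (auto simp: pair_prob_def)

lemma row_step_swap:
  "rank y < rank x \<Longrightarrow> (a @ x # y # b, a @ y # x # b) \<in> row_step"
  using swap_at_append[of a x y b] swap_prob_append[of \<alpha> \<beta> \<gamma> a x y b] pair_prob_rank[of x y]
  unfolding row_step_def by (intro CollectI exI[of _ "a @ x # y # b"] exI[of _ "Suc (length a)"]) auto

lemma row_steps_insort: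
  "(a @ x # w @ b, a @ insort_key rank x w @ b) \<in> row_step\<^sup>*"
proof (induction w arbitrary: a)
  case (Cons y w)
  show ?case
  proof (cases "rank x \<le> rank y")
    case False
    then have "(a @ x # y # w @ b, a @ y # x # w @ b) \<in> row_step" by (intro row_step_swap) simp
    moreover have "((a @ [y]) @ x # w @ b, (a @ [y]) @ insort_key rank x w @ b) \<in> row_step\<^sup>*" by (rule Cons.IH)
    ultimately show ?thesis using False by (simp add: converse_rtrancl_into_rtrancl)
  qed simp
qed simp

lemma row_steps_sort:
  "(a @ w @ b, a @ sort_key rank w @ b) \<in> row_step\<^sup>*"
proof (induction w arbitrary: a)
  case (Cons x w)
  have "((a @ [x]) @ w @ b, (a @ [x]) @ sort_key rank w @ b) \<in> row_step\<^sup>*" by (rule Cons.IH)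
  then show ?case using row_steps_insort[of a x "sort_key rank w" b] by simp
qed simp

definition target_row :: row where
  "target_row = replicate l Neutral @ replicate m White @ replicate k Black"

lemma sort_rank:
  assumes "mset xs = mset ys" "sorted (map rank ys)" shows "sort_key rank xs = ys"
  by (rule sort_key_inj_key_eq[OF assms(1) _ assms(2)]) (rule inj_on_subset[OF inj_rank], simp)

text \<open>Linear sorting gives white, neutral, black. Read on the circle from the neutrals on, the
  blacks then precede the whites, so the arc behind the neutrals is sorted once more after a
  rotation by \<open>m\<close>.\<close>

lemma row_reaches_target:
  assumes "mset t = row_mset k l m"
  shows "\<exists>t'. rotate m t' = target_row \<and> (t, t') \<in> row_step\<^sup>*"
proof -
  let ?s = "replicate m White @ replicate l Neutral @ replicate k Black"
  have "sort_key rank t = ?s"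
    using assms by (intro sort_rank) (auto simp: row_mset_def sorted_append)
  then have 1: "(t, ?s) \<in> row_step\<^sup>*" using row_steps_sort[of "[]" t "[]"] by simp
  have r: "rotate m ?s = replicate l Neutral @ (replicate k Black @ replicate m White) @ []"
    using rotate_append[of "replicate m White"] by simp
  have "sort_key rank (replicate k Black @ replicate m White) = replicate m White @ replicate k Black"
    by (intro sort_rank) (auto simp: sorted_append)
  then have "(rotate m ?s, target_row) \<in> row_step\<^sup>*"
    using row_steps_sort[of "replicate l Neutral" "replicate k Black @ replicate m White" "[]"] r
    by (simp add: target_row_def)
  from row_steps_rotate[OF this refl] 1 show ?thesis by (metis rtrancl_trans)
qed

definition target_word :: "column list" where
  "target_word = replicate m (White, Black) @ replicate k (Black, White)"

definition target_cols :: "column list" where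
  "target_cols = replicate l neutral @ target_word"

text \<open>Rotation by \<open>n - m\<close> undoes the rotation by \<open>m\<close> that brings the
  neutral columns to the front.\<close>

definition target :: config where
  "target = cfg (rotate (n - m) target_cols)"

text \<open>Columns under a white top have excess at most 0, those under a black top at least 0.
  Positivity forces the white part to have excess 0, balance then the black part, and so every
  single column.\<close>

lemma sorted_word_unique:
  assumes "word w" "map fst w = replicate m White @ replicate k Black" shows "w = target_word"
proof -
  obtain a b where w: "w = a @ b" "map fst a = replicate m White" "map fst b = replicate k Black"
    using assms(2) by (auto simp: map_eq_append_conv)
  have la: "length a = m" "length b = k" using w(2,3) by (metis length_map length_replicate)+
  have s: "set w \<subseteq> {Black, White} \<times> {Black, White}" using assms(1) by (simp add: word_iff)
  have "set (map fst a) \<subseteq> {White}" "set (map fst b) \<subseteq> {Black}" unfolding w(2,3) by auto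
  then have sa: "set a \<subseteq> {(White, Black), (White, White)}" and sb: "set b \<subseteq> {(Black, Black), (Black, White)}"
    using s w(1) by fastforce+
  have A: "excess a \<le> 0 \<and> (excess a = 0 \<longrightarrow> a = replicate (length a) (White, Black))"
    using sa by (induction a) auto
  have B: "0 \<le> excess b \<and> (excess b = 0 \<longrightarrow> b = replicate (length b) (Black, White))"
    using sb by (induction b) auto
  have "0 \<le> excess a" "excess a + excess b = 0" using assms(1) w(1) by (auto simp: word_iff)
  then show ?thesis using A B w(1) la by (simp add: target_word_def)
qed

lemma word_target: "word target_word"
proof -
  have "word (replicate j (White, Black))" for j
    by (induction j) (use word_insert_WB[of "[]"] in auto)
  moreover have "word (replicate j (Black, White))" for j
    by (induction j) (use word_insert_BW[of "[]"] in auto)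
  ultimately show ?thesis unfolding target_word_def by (intro word_append)
qed

lemma lin_sum_replicate:
  assumes "neutral \<notin> set w"
  shows "lin_sum g (replicate (Suc j) neutral @ w) = j * g [] + g w"
proof (induction j)
  case 0
  have tw: "takeWhile (\<lambda>c. c \<noteq> neutral) w = w" using assms unfolding takeWhile_eq_all_conv by blast
  have "lin_sum g w = 0" using lin_sum_append[OF assms, of g "[]"] by (simp add: lin_sum_def)
  then show ?case by (simp add: lin_sum_Cons head_term_def tw)
next
  case (Suc j)
  then show ?case using lin_sum_Cons[of g neutral "replicate (Suc j) neutral @ w"] by (simp add: head_term_def)
qed

text \<open>Consecutive neutral columns enclose empty words, which have no defect.\<close>

lemma defects_replicate:
  assumes "neutral \<notin> set w"
  shows "circ_sum defects (replicate l neutral @ w) = 0 \<longleftrightarrow> balanced w \<and> positive w"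
proof -
  obtain j where j: "l = Suc j" using l by (cases l) auto
  have "circ_sum defects (replicate l neutral @ w) = j * defects [] + defects w"
    unfolding j lin_sum_replicate[OF assms, symmetric] by (intro circ_sum_lin_sum) simp
  then show ?thesis using word_Nil by (simp add: defects_def word_def del: word_Nil)
qed

lemma target_in: "target \<in> \<Omega>"
proof -
  have "neutral \<notin> set target_word" by (auto simp: target_word_def)
  then have "circ_sum defects target_cols = 0"
    using defects_replicate word_target by (simp add: target_cols_def word_def)
  moreover have "proper target_cols"
    using l by (auto simp: proper_def target_cols_def target_word_def)
  ultimately have "admissible (rotate (n - m) target_cols)"
    unfolding admissible_rotate by (simp add: admissible_def)
  moreover have "mset (map fst (rotate (n - m) target_cols)) = row_mset k l m"
    by (simp add: mset_rotate target_cols_def target_word_def row_mset_def)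
  ultimately show ?thesis unfolding target_def complete_configs_iff[OF l] by blast
qed

lemma target_unique:
  assumes "\<omega> \<in> \<Omega>" "rotate m (fst \<omega>) = target_row" shows "\<omega> = target"
proof -
  obtain cs where cs: "\<omega> = cfg cs" "mset (map fst cs) = row_mset k l m" "admissible cs"
    using assms(1) complete_configs_iff[OF l] by blast
  have n: "length cs = n" using length_row[OF cs(2)] by simp
  let ?R = "rotate m cs"
  have ad: "admissible ?R" using cs by (simp add: admissible_rotate)
  have top: "map fst ?R = replicate l Neutral @ replicate m White @ replicate k Black"
    using assms(2) cs by (simp add: fst_cfg rotate_map target_row_def)
  from map_eq_append_conv[THEN iffD1, OF top]
  obtain a w where R: "?R = a @ w" "map fst a = replicate l Neutral" "map fst w = replicate m White @ replicate k Black"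
    by metis
  have p: "\<And>c. c \<in> set ?R \<Longrightarrow> fst c = Neutral \<longleftrightarrow> c = neutral"
    using proper_neutral[of ?R] ad unfolding admissible_def by blast
  have fa: "fst c = Neutral" if "c \<in> set a" for c
  proof -
    have "fst c \<in> set (map fst a)" using that by auto
    then show ?thesis unfolding R(2) by simp
  qed
  have "\<forall>c\<in>set a. c = neutral" using fa p R(1) by auto
  moreover have "length a = l" using arg_cong[OF R(2), of length] by simp
  ultimately have a: "a = replicate l neutral" by (metis replicate_length_same)
  have nw: "neutral \<notin> set w"
  proof
    assume "neutral \<in> set w"
    then have "Neutral \<in> set (map fst w)" by force
    then show False unfolding R(3) by auto
  qed
  have "circ_sum defects (replicate l neutral @ w) = 0" using ad R a by (simp add: admissible_def)
  moreover have "set w \<subseteq> {Black, White} \<times> {Black, White}"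
    using ad R(1) nw by (intro proper_word[of ?R]) (auto simp: admissible_def)
  ultimately have "word w" using defects_replicate[OF nw] by (simp add: word_def)
  then have eq: "?R = target_cols" using sorted_word_unique R a by (simp add: target_cols_def)
  then have "rotate (n - m) target_cols = cs" using n by (simp add: rotate_rotate flip: eq)
  then show ?thesis using cs by (simp only: target_def)
qed

lemma reaches_target:
  assumes "\<omega> \<in> \<Omega>"
  shows "(\<omega>, target) \<in> {(x, y). y \<in> set_pmf (step \<alpha> \<beta> \<gamma> x)}\<^sup>*"
proof -
  have "mset (fst \<omega>) = row_mset k l m" using assms complete_configs_iff[OF l] by (auto simp: fst_cfg)
  then obtain t' where "rotate m t' = target_row" "(fst \<omega>, t') \<in> row_step\<^sup>*"
    using row_reaches_target by blast
  then show ?thesis using lift_row_steps[OF _ assms refl] target_unique by metis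
qed

text \<open>At a wall with a particle of maximal rank on its right there is no descent, so choosing
  this wall changes nothing.\<close>

lemma idle_step:
  assumes "\<omega> \<in> \<Omega>" shows "\<omega> \<in> set_pmf (step \<alpha> \<beta> \<gamma> \<omega>)"
proof -
  let ?t = "fst \<omega>"
  have n: "length ?t = n" "0 < n" using length_config[OF assms] l by auto
  let ?A = "(\<lambda>i. rank (?t ! i)) ` {..<n}"
  have "Max ?A \<in> ?A" using n(2) by (intro Max_in) auto
  then obtain i where i: "i < n" "rank (?t ! i) = Max ?A" by auto
  have "left_cell n i < n" using n(2) by simp
  then have "rank (?t ! left_cell n i) \<le> rank (?t ! i)" unfolding i(2) by (intro Max_ge) auto
  then have "prob_at \<omega> i = 0" 
    using pair_prob_rank[of "?t ! left_cell n i" "?t ! i"] by (simp add: swap_prob_pair n)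
  then show ?thesis by (intro step_reaches[OF assms i(1)]) simp
qed

section \<open>Normalization, limit and uniqueness\<close>

definition stationary_pmf :: "config pmf" where
  "stationary_pmf = embed_pmf (\<lambda>\<omega>. if \<omega> \<in> \<Omega> then q \<omega> / (\<Sum>\<omega>'\<in>\<Omega>. q \<omega>') else 0)"

lemma pmf_stationary_pmf:
  "pmf stationary_pmf \<omega> = (if \<omega> \<in> \<Omega> then q \<omega> / (\<Sum>\<omega>'\<in>\<Omega>. q \<omega>') else 0)"
  unfolding stationary_pmf_def
proof (rule pmf_embed_pmf)
  let ?Z = "\<Sum>\<omega>'\<in>\<Omega>. q \<omega>'"
  have fin: "finite \<Omega>" by (rule finite_complete_configs[OF l])
  \<comment> \<open>The configuration \<open>target\<close> shows that the state space is
    non-empty.\<close>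
  have Z: "0 < ?Z" using fin target_in weight_pos by (intro sum_pos) auto
  show nn: "0 \<le> (if \<omega> \<in> \<Omega> then q \<omega> / ?Z else 0)" for \<omega>
    using Z weight_pos[of \<omega>] by simp
  have "(\<integral>\<^sup>+\<omega>. ennreal (if \<omega> \<in> \<Omega> then q \<omega> / ?Z else 0) \<partial>count_space UNIV)
      = (\<Sum>\<omega>\<in>\<Omega>. ennreal (if \<omega> \<in> \<Omega> then q \<omega> / ?Z else 0))"
    by (rule nn_integral_count_space'[OF fin]) auto
  also have "\<dots> = ennreal (\<Sum>\<omega>\<in>\<Omega>. if \<omega> \<in> \<Omega> then q \<omega> / ?Z else 0)" by (intro sum_ennreal nn)
  also have "(\<Sum>\<omega>\<in>\<Omega>. if \<omega> \<in> \<Omega> then q \<omega> / ?Z else 0) = 1"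
    using Z by (simp flip: sum_divide_distrib)
  finally show "(\<integral>\<^sup>+\<omega>. ennreal (if \<omega> \<in> \<Omega> then q \<omega> / ?Z else 0) \<partial>count_space UNIV) = 1" by simp
qed

lemma stationary_stationary_pmf:
  "stationary_distribution \<Omega> (step \<alpha> \<beta> \<gamma>) stationary_pmf"
proof -
  have fin: "finite \<Omega>" by (rule finite_complete_configs[OF l])
  have sub: "set_pmf stationary_pmf \<subseteq> \<Omega>"
    by (auto simp: set_pmf_iff pmf_stationary_pmf split: if_splits)
  have "pmf (bind_pmf stationary_pmf (step \<alpha> \<beta> \<gamma>)) \<omega> = pmf stationary_pmf \<omega>" for \<omega>
  proof (cases "\<omega> \<in> \<Omega>")
    case True
    have "pmf (bind_pmf stationary_pmf (step \<alpha> \<beta> \<gamma>)) \<omega>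
        = (\<Sum>x\<in>\<Omega>. q x * pmf (step \<alpha> \<beta> \<gamma> x) \<omega>) / (\<Sum>\<omega>'\<in>\<Omega>. q \<omega>')"
      by (simp add: pmf_bind_finite[OF fin sub] pmf_stationary_pmf sum_divide_distrib)
    then show ?thesis using True by (simp add: weight_stationary pmf_stationary_pmf)
  next
    case False
    then have "pmf (step \<alpha> \<beta> \<gamma> x) \<omega> = 0" if "x \<in> \<Omega>" for x
      using step_closed[OF that] by (auto simp: set_pmf_iff)
    then show ?thesis using False by (simp add: pmf_bind_finite[OF fin sub] pmf_stationary_pmf)
  qed
  then show ?thesis using sub by (simp add: stationary_distribution_def pmf_eq_iff)
qed

lemma law_converges:
  assumes "set_pmf \<mu> \<subseteq> \<Omega>"
  shows "(\<lambda>t. pmf (law_at (step \<alpha> \<beta> \<gamma>) \<mu> t) \<omega>) \<longlonglongrightarrow> pmf stationary_pmf \<omega>"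
  using law_at_converges[OF finite_complete_configs[OF l] step_closed target_in
      idle_step[OF target_in] reaches_target stationary_stationary_pmf assms] .

text \<open>Started in a stationary law the chain keeps it, so this law is its own limit.\<close>

lemma stationary_unique:
  assumes "stationary_distribution \<Omega> (step \<alpha> \<beta> \<gamma>) \<pi>" shows "\<pi> = stationary_pmf"
proof (rule pmf_eqI)
  fix \<omega>
  have "set_pmf \<pi> \<subseteq> \<Omega>" "bind_pmf \<pi> (step \<alpha> \<beta> \<gamma>) = \<pi>"
    using assms by (auto simp: stationary_distribution_def)
  moreover from this(2) have "law_at (step \<alpha> \<beta> \<gamma>) \<pi> t = \<pi>" for t
    by (induction t) (simp_all add: law_at_Suc)
  ultimately show "pmf \<pi> \<omega> = pmf stationary_pmf \<omega>"
    using law_converges[of \<pi> \<omega>] by (simp add: LIMSEQ_const_iff)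
qed

end

theorem theorem6:
  fixes \<alpha> \<beta> \<gamma> :: real and k l m :: nat
  assumes "0 < \<alpha>" "\<alpha> \<le> 1" "0 < \<beta>" "\<beta> \<le> 1" "0 < \<gamma>" "\<gamma> \<le> 1"
    and "l \<ge> 1"
  shows "let \<Omega> = complete_configs k l m;
             K = step \<alpha> \<beta> \<gamma>;
             q = weight \<alpha> \<beta> \<gamma>;
             Z = (\<Sum>\<omega>'\<in>\<Omega>. q \<omega>')
         in (\<exists>!\<pi>. stationary_distribution \<Omega> K \<pi>) \<and>
            (\<forall>\<pi>. stationary_distribution \<Omega> K \<pi> \<longrightarrow> (\<forall>\<omega>\<in>\<Omega>. pmf \<pi> \<omega> = q \<omega> / Z)) \<and>
            (\<forall>\<mu>. set_pmf \<mu> \<subseteq> \<Omega> \<longrightarrow>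
               (\<forall>\<omega>\<in>\<Omega>. (\<lambda>t. pmf (law_at K \<mu> t) \<omega>) \<longlonglongrightarrow> q \<omega> / Z))"
  unfolding Let_def
proof -
  interpret three_tasep \<alpha> \<beta> \<gamma> k l m using assms by unfold_locales
  show "(\<exists>!\<pi>. stationary_distribution \<Omega> (step \<alpha> \<beta> \<gamma>) \<pi>) \<and>
      (\<forall>\<pi>. stationary_distribution \<Omega> (step \<alpha> \<beta> \<gamma>) \<pi> \<longrightarrow> (\<forall>\<omega>\<in>\<Omega>. pmf \<pi> \<omega> = q \<omega> / sum q \<Omega>)) \<and>
      (\<forall>\<mu>. set_pmf \<mu> \<subseteq> \<Omega> \<longrightarrow>
         (\<forall>\<omega>\<in>\<Omega>. (\<lambda>t. pmf (law_at (step \<alpha> \<beta> \<gamma>) \<mu> t) \<omega>) \<longlonglongrightarrow> q \<omega> / sum q \<Omega>))"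
  proof (intro conjI allI impI ballI)
    show "\<exists>!\<pi>. stationary_distribution \<Omega> (step \<alpha> \<beta> \<gamma>) \<pi>"
      using stationary_stationary_pmf stationary_unique by blast
  next
    fix \<pi> \<omega> assume "stationary_distribution \<Omega> (step \<alpha> \<beta> \<gamma>) \<pi>" "\<omega> \<in> \<Omega>"
    then have "\<pi> = stationary_pmf" "\<omega> \<in> \<Omega>" using stationary_unique by auto
    then show "pmf \<pi> \<omega> = q \<omega> / sum q \<Omega>" by (simp add: pmf_stationary_pmf)
  next
    fix \<mu> \<omega> assume "set_pmf \<mu> \<subseteq> \<Omega>" "\<omega> \<in> \<Omega>"
    then show "(\<lambda>t. pmf (law_at (step \<alpha> \<beta> \<gamma>) \<mu> t) \<omega>) \<longlonglongrightarrow> q \<omega> / sum q \<Omega>"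
      using law_converges[of \<mu> \<omega>] by (simp add: pmf_stationary_pmf)
  qed
qed

end
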